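(* Let $P:\{-1,1\}^k\to\{0,1\}$ be an even predicate such that for every positive integer $m$ there exists a distribution $\Lambda$ which is $m$-vanishing on $P$. Then for every $\varepsilon>0$ there exists $\delta>0$ such that for all $n$ the following holds. There is a randomized algorithm $\mathcal{T}$ which, given oracle access to $k$ odd functions $f_1,\dots,f_k:\{-1,1\}^n\to[-1,1]$, produces $k$ queries $X_1,\dots,X_k\in\{-1,1\}^n$ such that: (Yes) if $f_1(x)=f_2(x)=\dots=f_k(x)=x_i$ for some fixed $i\in[n]$, then $\mathbb{E}[P(f_1(X_1),\dots,f_k(X_k))]\ge1-\varepsilon$; (No) if $\mathrm{Inf}^{\le1/\delta}_j(f_i)\le\delta$ for all $i\in[k]$ and $j\in[n]$, then $\mathbb{E}[P(f_1(X_1),\dots,f_k(X_k))]\le\hat P(\emptyset)+\varepsilon$.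
   Context: Every $f:\{-1,1\}^n\to\mathbb{R}$ is written uniquely as $f(x)=\sum_{T\subseteq[n]}\hat f(T)\prod_{i\in T}x_i$, and is identified with this multilinear polynomial; in particular $P$ is evaluated on $[-1,1]^k$ via its multilinear extension, and $\hat P(S)$ are its Fourier coefficients ($\hat P(\emptyset)=|P^{-1}(1)|/2^k$). $f$ is odd if $f(-x)=-f(x)$. The low-degree influence is $\mathrm{Inf}^{\le d}_j(f)=\sum_{T\ni j,\,|T|\le d}\hat f(T)^2$. $P$ is even if $P(x)=P(-x)$. A distribution $\mu$ on $\{-1,1\}^k$ is $P$-supported if its support is in $P^{-1}(1)$; $\rho\in\mathbb{R}^{k\times k}$ is a $P$-supported correlation matrix if $\rho_{ij}=\mathbb{E}_{x\sim\mu}[x_ix_j]$ for some $P$-supported $\mu$. A multigraph may have multiple edges but no self-loops; a multigraph on $S\subseteq[k]$ has vertex set $S$; it has odd degree if every vertex has odd degree counting multiplicities. For a multigraph $G=(S,E)$, $\rho(G)=\prod_{ij\in E}\rho_{ij}$, and for a distribution $\Lambda$ over correlation matrices $\Lambda(G)=\mathbb{E}_{\rho\sim\Lambda}[\rho(G)]$. $\Lambda$ is $m$-vanishing on $P$ if it is a distribution over $P$-supported correlation matrices and $\Lambda(G)=0$ for every $S\subseteq[k]$ with $\hat P(S)\neq0$ and every odd-degree multigraph $G$ on $S$ with at most $m$ edges. *)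

theory Defs
  imports "HOL-Probability.Probability" "HOL-Library.Multiset"
begin

section \<open>Fourier analysis on the discrete cube\<close>

text \<open>
  Points of the cube \<open>{-1,1}\<^sup>n\<close> are extensional functions on the index set \<open>{1..n}\<close>; for a fixed
  arity \<open>k\<close> the index set is the universe of a finite type.
\<close>

definition cube :: "'i set \<Rightarrow> ('i \<Rightarrow> real) set" where
  "cube I = (\<Pi>\<^sub>E i\<in>I. {-1, 1})"

definition antipode :: "'i set \<Rightarrow> ('i \<Rightarrow> real) \<Rightarrow> 'i \<Rightarrow> real" where
  "antipode I x = (\<lambda>i\<in>I. - x i)"

definition fourier_coeff :: "'i set \<Rightarrow> (('i \<Rightarrow> real) \<Rightarrow> real) \<Rightarrow> 'i set \<Rightarrow> real" where
  "fourier_coeff I f T = (\<Sum>x\<in>cube I. f x * (\<Prod>i\<in>T. x i)) / 2 ^ card I"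

definition multilinear_ext :: "'i set \<Rightarrow> (('i \<Rightarrow> real) \<Rightarrow> real) \<Rightarrow> ('i \<Rightarrow> real) \<Rightarrow> real" where
  "multilinear_ext I f z = (\<Sum>T\<in>Pow I. fourier_coeff I f T * (\<Prod>i\<in>T. z i))"

definition odd_function :: "'i set \<Rightarrow> (('i \<Rightarrow> real) \<Rightarrow> real) \<Rightarrow> bool" where
  "odd_function I f \<longleftrightarrow> (\<forall>x\<in>cube I. f (antipode I x) = - f x)"

definition even_function :: "'i set \<Rightarrow> (('i \<Rightarrow> real) \<Rightarrow> real) \<Rightarrow> bool" where
  "even_function I f \<longleftrightarrow> (\<forall>x\<in>cube I. f (antipode I x) = f x)"

definition low_degree_influence ::
    "'i set \<Rightarrow> real \<Rightarrow> 'i \<Rightarrow> (('i \<Rightarrow> real) \<Rightarrow> real) \<Rightarrow> real" where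
  "low_degree_influence I d j f =
     (\<Sum>T\<in>{T \<in> Pow I. j \<in> T \<and> real (card T) \<le> d}. (fourier_coeff I f T)\<^sup>2)"

text \<open>
  The coefficients \<open>fourier_coeff I f\<close> are the unique coefficients of an expansion of \<open>f\<close> as a
  multilinear polynomial on the cube.
\<close>

lemma finite_cube: "finite I \<Longrightarrow> finite (cube I)"
  unfolding cube_def by (intro finite_PiE) auto

lemma card_cube: "finite I \<Longrightarrow> card (cube I) = 2 ^ card I"
  unfolding cube_def by (simp add: card_PiE numeral_2_eq_2)

lemma cube_range: "x \<in> cube I \<Longrightarrow> i \<in> I \<Longrightarrow> x i = -1 \<or> x i = 1"
  unfolding cube_def by (auto dest: PiE_mem)

lemma multilinear_ext_on_cube:
  assumes I: "finite I" and x: "x \<in> cube I"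
  shows "multilinear_ext I f x = f x"
proof -
  have ker: "(\<Sum>T\<in>Pow I. (\<Prod>i\<in>T. y i) * (\<Prod>i\<in>T. x i)) = (if y = x then 2 ^ card I else 0)"
    if y: "y \<in> cube I" for y
  proof -
    have "(\<Sum>T\<in>Pow I. (\<Prod>i\<in>T. y i) * (\<Prod>i\<in>T. x i)) = (\<Prod>i\<in>I. y i * x i + 1)"
      by (simp add: prod_add I prod.distrib)
    also have "\<dots> = (if y = x then 2 ^ card I else 0)"
    proof (cases "y = x")
      case True
      have "y i * x i + 1 = 2" if "i \<in> I" for i
        using cube_range[OF x that] True by auto
      then show ?thesis using True by simp
    next
      case False
      then obtain i where i: "i \<in> I" "y i \<noteq> x i"
        using x y unfolding cube_def by (meson PiE_ext)
      then have "y i * x i + 1 = 0"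
        using cube_range[OF x i(1)] cube_range[OF y i(1)] by auto
      then have "(\<Prod>i\<in>I. y i * x i + 1) = 0"
        using I i(1) by (meson prod_zero)
      then show ?thesis using False by simp
    qed
    finally show ?thesis .
  qed
  have "multilinear_ext I f x =
      (\<Sum>T\<in>Pow I. \<Sum>y\<in>cube I. f y * ((\<Prod>i\<in>T. y i) * (\<Prod>i\<in>T. x i)) / 2 ^ card I)"
    unfolding multilinear_ext_def fourier_coeff_def
    by (simp add: sum_divide_distrib sum_distrib_right mult.assoc)
  also have "\<dots> = (\<Sum>y\<in>cube I. f y *
      (\<Sum>T\<in>Pow I. (\<Prod>i\<in>T. y i) * (\<Prod>i\<in>T. x i)) / 2 ^ card I)"
    by (subst sum.swap) (simp add: sum_divide_distrib sum_distrib_left)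
  also have "\<dots> = (\<Sum>y\<in>cube I. if y = x then f y else 0)"
    by (intro sum.cong refl) (simp add: ker)
  also have "\<dots> = f x"
    using finite_cube[OF I] x by simp
  finally show ?thesis .
qed

lemma fourier_coeff_unique:
  assumes I: "finite I" and T: "T \<subseteq> I"
    and f: "\<And>x. x \<in> cube I \<Longrightarrow> f x = (\<Sum>U\<in>Pow I. c U * (\<Prod>i\<in>U. x i))"
  shows "fourier_coeff I f T = c T"
proof -
  have orth: "(\<Sum>x\<in>cube I. (\<Prod>i\<in>U. x i) * (\<Prod>i\<in>T. x i)) = (if U = T then 2 ^ card I else 0)"
    if U: "U \<subseteq> I" for U
  proof -
    have ind: "(\<Prod>i\<in>V. x i) = (\<Prod>i\<in>I. if i \<in> V then x i else 1)"
      if "V \<subseteq> I" for V and x :: "'a \<Rightarrow> real"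
      using that I by (simp add: prod.If_cases Int_absorb1)
    have "(\<Sum>x\<in>cube I. (\<Prod>i\<in>U. x i) * (\<Prod>i\<in>T. x i)) =
        (\<Sum>x\<in>cube I. \<Prod>i\<in>I. (if i \<in> U then x i else 1) * (if i \<in> T then x i else 1))"
      by (simp add: ind[OF U] ind[OF T] prod.distrib)
    also have "\<dots> = (\<Prod>i\<in>I. \<Sum>b\<in>{-1, 1}. (if i \<in> U then b else 1) * (if i \<in> T then b else 1))"
      unfolding cube_def by (rule prod_sum_PiE[symmetric]) (use I in auto)
    also have "\<dots> = (\<Prod>i\<in>I. if i \<in> U \<longleftrightarrow> i \<in> T then 2 else 0)"
      by (intro prod.cong) auto
    also have "\<dots> = (if U = T then 2 ^ card I else 0)"
    proof (cases "U = T")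
      case False
      then obtain i where "i \<in> I" "\<not> (i \<in> U \<longleftrightarrow> i \<in> T)" using U T by blast
      then have "\<exists>i\<in>I. (if i \<in> U \<longleftrightarrow> i \<in> T then 2 else 0 :: real) = 0"
        by (intro bexI[of _ i]) auto
      then have "(\<Prod>i\<in>I. if i \<in> U \<longleftrightarrow> i \<in> T then 2 else 0 :: real) = 0"
        by (rule prod_zero[OF I])
      with False show ?thesis by simp
    qed simp
    finally show ?thesis .
  qed
  have "(\<Sum>x\<in>cube I. f x * (\<Prod>i\<in>T. x i)) =
      (\<Sum>x\<in>cube I. \<Sum>U\<in>Pow I. c U * ((\<Prod>i\<in>U. x i) * (\<Prod>i\<in>T. x i)))"
    by (intro sum.cong refl) (simp add: f sum_distrib_right mult.assoc)
  also have "\<dots> = (\<Sum>U\<in>Pow I. c U * (\<Sum>x\<in>cube I. (\<Prod>i\<in>U. x i) * (\<Prod>i\<in>T. x i)))"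
    by (subst sum.swap) (simp add: sum_distrib_left)
  also have "\<dots> = (\<Sum>U\<in>Pow I. if U = T then c T * 2 ^ card I else 0)"
    by (intro sum.cong refl) (simp add: orth)
  also have "\<dots> = c T * 2 ^ card I"
    using I T by simp
  finally show ?thesis
    unfolding fourier_coeff_def by simp
qed

lemma fourier_coeff_empty_predicate:
  assumes "finite I" and "\<And>x. x \<in> cube I \<Longrightarrow> P x \<in> {0, 1}"
  shows "fourier_coeff I P {} = real (card {x \<in> cube I. P x = 1}) / 2 ^ card I"
proof -
  have "(\<Sum>x\<in>cube I. P x) = (\<Sum>x\<in>cube I. if P x = 1 then 1 else 0)"
    using assms(2) by (intro sum.cong) auto
  also have "\<dots> = real (card {x \<in> cube I. P x = 1})"
    using finite_cube[OF assms(1)] by (simp add: sum.If_cases Int_def)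
  finally show ?thesis by (simp add: fourier_coeff_def)
qed

section \<open>Supported correlation matrices and vanishing distributions\<close>

definition supported_distribution :: "(('k \<Rightarrow> real) \<Rightarrow> real) \<Rightarrow> ('k \<Rightarrow> real) pmf \<Rightarrow> bool" where
  "supported_distribution P \<mu> \<longleftrightarrow> set_pmf \<mu> \<subseteq> {x \<in> cube UNIV. P x = 1}"

definition supported_correlation ::
    "(('k::finite \<Rightarrow> real) \<Rightarrow> real) \<Rightarrow> real^'k^'k \<Rightarrow> bool" where
  "supported_correlation P \<rho> \<longleftrightarrow>
     (\<exists>\<mu>. supported_distribution P \<mu> \<and>
          (\<forall>i j. \<rho> $ i $ j = measure_pmf.expectation \<mu> (\<lambda>x. x i * x j)))"

lemma supported_correlation_sym:
  "supported_correlation P \<rho> \<Longrightarrow> \<rho> $ i $ j = \<rho> $ j $ i"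
  unfolding supported_correlation_def by (auto simp: mult.commute)

text \<open>
  A multigraph is given by the multiset of its edges. Each edge is recorded as a pair of its
  endpoints in an arbitrary order; this order is immaterial for \<open>edge_weight\<close> because correlation
  matrices are symmetric.
\<close>

type_synonym 'k multigraph = "('k \<times> 'k) multiset"

definition multigraph_on :: "'k set \<Rightarrow> 'k multigraph \<Rightarrow> bool" where
  "multigraph_on S G \<longleftrightarrow> (\<forall>(i, j)\<in>set_mset G. i \<in> S \<and> j \<in> S \<and> i \<noteq> j)"

definition vertex_degree :: "'k multigraph \<Rightarrow> 'k \<Rightarrow> nat" where
  "vertex_degree G v = size {#e \<in># G. v = fst e \<or> v = snd e#}"

definition odd_degree :: "'k set \<Rightarrow> 'k multigraph \<Rightarrow> bool" where
  "odd_degree S G \<longleftrightarrow> (\<forall>v\<in>S. odd (vertex_degree G v))"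

definition edge_weight :: "real^'k^'k \<Rightarrow> 'k multigraph \<Rightarrow> real" where
  "edge_weight \<rho> G = (\<Prod>(i, j)\<in>#G. \<rho> $ i $ j)"

text \<open>
  Vertex sets are required to be nonempty: the edgeless graph on the empty set has odd degree
  vacuously and weight 1, so including it would make \<open>vanishing\<close> unsatisfiable.
\<close>

definition vanishing ::
    "nat \<Rightarrow> (('k::finite \<Rightarrow> real) \<Rightarrow> real) \<Rightarrow> (real^'k^'k) measure \<Rightarrow> bool" where
  "vanishing m P \<Lambda> \<longleftrightarrow>
     prob_space \<Lambda> \<and> sets \<Lambda> = sets borel \<and> (AE \<rho> in \<Lambda>. supported_correlation P \<rho>) \<and>
     (\<forall>S G. S \<noteq> {} \<and> fourier_coeff UNIV P S \<noteq> 0 \<and>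
            multigraph_on S G \<and> odd_degree S G \<and> size G \<le> m \<longrightarrow>
            (\<integral>\<rho>. edge_weight \<rho> G \<partial>\<Lambda>) = 0)"

section \<open>Query distributions\<close>

text \<open>
  A nonadaptive randomized algorithm making one query to each of \<open>k\<close> oracles on \<open>{-1,1}\<^sup>n\<close> is the
  joint distribution of its \<open>k\<close> queries, which does not depend on the oracles.
\<close>

definition query_algorithm :: "nat \<Rightarrow> ('k \<Rightarrow> nat \<Rightarrow> real) pmf \<Rightarrow> bool" where
  "query_algorithm n \<T> \<longleftrightarrow> set_pmf \<T> \<subseteq> {X. \<forall>i. X i \<in> cube {1..n}}"

definition acceptance ::
    "(('k::finite \<Rightarrow> real) \<Rightarrow> real) \<Rightarrow> ('k \<Rightarrow> nat \<Rightarrow> real) pmf \<Rightarrow>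
     ('k \<Rightarrow> (nat \<Rightarrow> real) \<Rightarrow> real) \<Rightarrow> real" where
  "acceptance P \<T> f =
     measure_pmf.expectation \<T> (\<lambda>X. multilinear_ext UNIV P (\<lambda>i. f i (X i)))"

end

theory Submission
  imports Defs
begin

text \<open>
  The test draws a correlation matrix from a vanishing distribution and, independently for each
  coordinate, a column from a supported distribution with these correlations, symmetrized (\<open>P\<close> is
  even) so that it is centered; then it flips every bit with small probability. Noise lets one
  replace each function by a low-degree truncation, and the acceptance probability becomes a
  combination of the expectations of products of truncated functions over nonempty sets \<open>S\<close> of
  queries.

  Expanding such a product into characters, each choice of characters contributes a product over
  the coordinates \<open>j\<close> of the moment indexed by the set of queries whose character contains \<open>j\<close>.
  Sets of size 1 give 0 since the columns are centered. If all sets have size 0 or 2, they form the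
  edges of a multigraph on \<open>S\<close>, of odd degree because the functions are odd, so the
  contribution vanishes on average over the correlation matrix. The remaining terms have a
  coordinate shared by at least three characters and are bounded through the influences. No
  invariance principle is needed: all these bounds follow from one multilinear inequality for sums
  over families of sets covering no point exactly once, which tensorizes over coordinates.
\<close>

section \<open>Families of sets covering no point exactly once\<close>

text \<open>All estimates must be uniform in \<open>n\<close> and in the column distribution:
  \<delta> is fixed before \<open>n\<close>, and the truncation degrees are fixed before the mixture
  is known. The constants form a chain: \<epsilon> determines the noise, the noise determines the
  truncation degrees, and the degrees determine the number \<open>m\<close> of edges to be
  cancelled. Only then are a vanishing distribution and \<delta> chosen. This is why vanishing is
  assumed for every \<open>m\<close>.

  Pairs and triples differ because of the size of influences. A coordinate \<open>j\<close> shared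
  by three characters costs three square roots of influences of \<open>j\<close>. One of them is at
  most \<open>sqrt \<delta>\<close>; the other two, summed over \<open>j\<close>, are bounded by
  total influences, hence by degrees. With two square roots no small factor would remain, so terms
  made of pairs cannot be bounded this way and have to cancel through the correlation
  matrix.\<close>

text \<open>In the application, \<open>u q\<close> and \<open>v q\<close> are the norms of the parts
  of the \<open>q\<close>-th factor without and with one coordinate. The square of the right side is
  the sum of the squares of all mixed products. A singleton would enter the left side to first order
  in \<open>v\<close>, whereas the right side exceeds the product of the \<open>u q\<close> only to
  second order. All other sets can be paid for by a small \<theta>.\<close>

lemma single_coordinate_bound:
  fixes u v :: "'q \<Rightarrow> real" and \<theta> :: real
  assumes Q: "finite Q" and u: "\<And>q. q \<in> Q \<Longrightarrow> u q \<ge> 0" and v: "\<And>q. q \<in> Q \<Longrightarrow> v q \<ge> 0"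
    and \<theta>: "\<theta> = 1 / 2 ^ Suc (card Q)"
  shows "(\<Sum>A\<in>Pow Q. of_bool (card A \<noteq> 1) * \<theta> ^ card A * ((\<Prod>q\<in>A. v q) * (\<Prod>q\<in>Q-A. u q)))
    \<le> (\<Prod>q\<in>Q. sqrt ((u q)\<^sup>2 + (v q)\<^sup>2))"
proof -
  define m where "m A = (\<Prod>q\<in>A. v q) * (\<Prod>q\<in>Q-A. u q)" for A
  define R where "R = (\<Sum>A\<in>Pow Q - {{}}. (m A)\<^sup>2)"
  define N :: real where "N = 2 ^ card Q"
  define B where "B = {A \<in> Pow Q. card A \<noteq> 1 \<and> A \<noteq> {}}"
  define E where "E = (\<Sum>A\<in>B. \<theta> ^ card A * m A)"
  have fP: "finite (Pow Q)" using Q by simp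
  have fB: "finite B" unfolding B_def using fP by simp
  have cB: "real (card B) \<le> N"
  proof -
    have "card B \<le> card (Pow Q)" by (rule card_mono[OF fP]) (auto simp: B_def)
    then show ?thesis using Q by (simp add: card_Pow N_def flip: of_nat_le_iff)
  qed
  have N1: "N \<ge> 1" unfolding N_def by simp
  \<comment> \<open>Since \<open>N\<close> bounds the number of sets in \<open>B\<close> and
    \<open>N * \<theta>\<^sup>2 = 1 / (4 * N)\<close>, this value absorbs the number of terms in
    both estimates of \<open>E\<close> below.\<close>
  have \<theta>N: "\<theta> = 1 / (2 * N)" unfolding \<theta> N_def by simp
  have \<theta>01: "0 < \<theta>" "\<theta> \<le> 1" using N1 by (auto simp: \<theta>N field_simps)
  have m0: "m A \<ge> 0" if "A \<subseteq> Q" for A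
    unfolding m_def using that by (intro mult_nonneg_nonneg prod_nonneg) (auto intro: u v)
  have R0: "R \<ge> 0" unfolding R_def by (intro sum_nonneg) auto
  have cB2: "card A \<ge> 2" if "A \<in> B" for A
  proof -
    have "finite A" using that Q by (auto simp: B_def intro: finite_subset)
    then have "card A \<noteq> 0" using that by (auto simp: B_def)
    moreover have "card A \<noteq> 1" using that by (auto simp: B_def)
    ultimately show ?thesis by linarith
  qed
  have \<theta>A: "\<theta> ^ card A \<le> \<theta>\<^sup>2" if "A \<in> B" for A
    using cB2[OF that] \<theta>01 by (intro power_decreasing) auto
  have mR: "(m A)\<^sup>2 \<le> R" if "A \<in> B" for A
    unfolding R_def using that fP by (intro member_le_sum[of A _ "\<lambda>A. (m A)\<^sup>2"]) (auto simp: B_def)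
  \<comment> \<open>Exchanging one element \<open>a\<close> turns \<open>m {} * m A\<close> into a
    product of two terms with distinct nonempty index sets, whose squares both occur in
    \<open>R\<close>. This uses \<open>card A \<ge> 2\<close>.\<close>
  have cross: "2 * (m {} * m A) \<le> R" if A: "A \<in> B" for A
  proof -
    obtain a where a: "a \<in> A" using A by (auto simp: B_def)
    have AQ: "A \<subseteq> Q" and fA: "finite A" using A Q by (auto simp: B_def intro: finite_subset)
    have ne: "A - {a} \<noteq> {}"
    proof
      assume "A - {a} = {}"
      then have "A \<subseteq> {a}" by blast
      then have "card A \<le> card {a}" by (intro card_mono) auto
      then show False using cB2[OF A] by simp
    qed
    have s1: "(\<Prod>q\<in>Q. u q) = u a * (\<Prod>q\<in>Q-{a}. u q)"
      using a AQ Q by (meson prod.remove subsetD)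
    have s2: "(\<Prod>q\<in>A. v q) = v a * (\<Prod>q\<in>A-{a}. v q)"
      using a fA by (meson prod.remove)
    have s3: "(\<Prod>q\<in>Q-(A-{a}). u q) = u a * (\<Prod>q\<in>Q-A. u q)"
    proof -
      have "Q - (A - {a}) = insert a (Q - A)" using a AQ by auto
      then show ?thesis using a Q by simp
    qed
    have eq: "m {} * m A = m {a} * m (A - {a})"
      unfolding m_def by (simp add: s1 s2 s3)
    have "2 * (m {a} * m (A - {a})) \<le> (m {a})\<^sup>2 + (m (A - {a}))\<^sup>2"
      using sum_squares_bound[of "m {a}" "m (A - {a})"] by simp
    also have "\<dots> = (\<Sum>C\<in>{{a}, A - {a}}. (m C)\<^sup>2)"
    proof -
      have "{a} \<noteq> A - {a}" by blast
      then show ?thesis by simp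
    qed
    also have "\<dots> \<le> R"
      unfolding R_def using ne a AQ fP by (intro sum_mono2) auto
    finally show ?thesis using eq by simp
  qed
  have E0: "E \<ge> 0"
    unfolding E_def using \<theta>01 m0 by (intro sum_nonneg mult_nonneg_nonneg) (auto simp: B_def)
  have cr: "2 * (m {} * E) \<le> R / 4"
  proof -
    have "2 * (m {} * E) = (\<Sum>A\<in>B. \<theta> ^ card A * (2 * (m {} * m A)))"
      unfolding E_def by (simp add: sum_distrib_left algebra_simps)
    also have "\<dots> \<le> (\<Sum>A\<in>B. \<theta>\<^sup>2 * R)"
      using \<theta>A cross \<theta>01 m0 by (intro sum_mono mult_mono) (auto simp: B_def)
    also have "\<dots> \<le> N * (\<theta>\<^sup>2 * R)"
      using cB R0 by (simp add: mult_right_mono)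
    also have "\<dots> = R / (4 * N)"
      unfolding \<theta>N using N1 by (simp add: field_simps power2_eq_square)
    also have "\<dots> \<le> R / 4"
      using N1 R0 by (intro divide_left_mono) auto
    finally show ?thesis .
  qed
  have "E \<le> (\<Sum>A\<in>B. \<theta>\<^sup>2 * sqrt R)"
    unfolding E_def using \<theta>A mR \<theta>01 m0
    by (intro sum_mono mult_mono real_le_rsqrt) (auto simp: B_def)
  also have "\<dots> \<le> N * (\<theta>\<^sup>2 * sqrt R)"
    using cB R0 by (simp add: mult_right_mono)
  also have "\<dots> = sqrt R / (4 * N)"
    unfolding \<theta>N using N1 by (simp add: field_simps power2_eq_square)
  also have "\<dots> \<le> sqrt R / 4"
    using N1 R0 by (intro divide_left_mono) auto
  finally have "E\<^sup>2 \<le> (sqrt R / 4)\<^sup>2"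
    using E0 by (intro power_mono) auto
  then have E2: "E\<^sup>2 \<le> R / 16" using R0 by (simp add: power_divide)
  have split: "(\<Sum>A\<in>Pow Q. of_bool (card A \<noteq> 1) * \<theta> ^ card A * m A) = m {} + E"
  proof -
    have "(\<Sum>A\<in>Pow Q. of_bool (card A \<noteq> 1) * \<theta> ^ card A * m A) =
      (\<Sum>A\<in>insert {} B. of_bool (card A \<noteq> 1) * \<theta> ^ card A * m A)"
      using fP by (intro sum.mono_neutral_right) (auto simp: B_def)
    also have "\<dots> = m {} + (\<Sum>A\<in>B. of_bool (card A \<noteq> 1) * \<theta> ^ card A * m A)"
      using fB by (subst sum.insert) (auto simp: B_def)
    also have "(\<Sum>A\<in>B. of_bool (card A \<noteq> 1) * \<theta> ^ card A * m A) = E"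
      unfolding E_def by (intro sum.cong) (auto simp: B_def)
    finally show ?thesis .
  qed
  have tot: "(\<Prod>q\<in>Q. (u q)\<^sup>2 + (v q)\<^sup>2) = (m {})\<^sup>2 + R"
  proof -
    have "(\<Prod>q\<in>Q. (v q)\<^sup>2 + (u q)\<^sup>2) = (\<Sum>A\<in>Pow Q. (m A)\<^sup>2)"
      unfolding m_def by (subst prod_add[OF Q]) (simp add: power_mult_distrib prod_power_distrib)
    also have "\<dots> = (m {})\<^sup>2 + R"
      unfolding R_def using fP by (simp add: sum.remove[of _ "{}"])
    finally show ?thesis by (simp add: add.commute)
  qed
  \<comment> \<open>The cross term costs at most \<open>R / 4\<close> and the square of
    \<open>E\<close> at most \<open>R / 16\<close>, together less than the available
    \<open>R\<close>.\<close>
  have "(m {} + E)\<^sup>2 \<le> (m {})\<^sup>2 + R"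
    using cr E2 R0 by (simp add: power2_sum algebra_simps)
  then have "m {} + E \<le> sqrt (\<Prod>q\<in>Q. (u q)\<^sup>2 + (v q)\<^sup>2)"
    unfolding tot by (rule real_le_rsqrt)
  also have "\<dots> = (\<Prod>q\<in>Q. sqrt ((u q)\<^sup>2 + (v q)\<^sup>2))"
    by (induction Q rule: infinite_finite_induct) (simp_all add: real_sqrt_mult)
  finally show ?thesis using split unfolding m_def by simp
qed

text \<open>A family is encoded by the set of its members containing \<open>j\<close> and by its
  traces on \<open>I\<close>. This splits off one coordinate in the induction of
  \<open>covering_sum_bound\<close>.\<close>

lemma PiE_Pow_insert_sum:
  fixes F :: "('q \<Rightarrow> 'i set) \<Rightarrow> real"
  assumes Q: "finite Q" and I: "finite I" "j \<notin> I"
  shows "(\<Sum>T\<in>(\<Pi>\<^sub>E q\<in>Q. Pow (insert j I)). F T) =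
    (\<Sum>A\<in>Pow Q. \<Sum>T\<in>(\<Pi>\<^sub>E q\<in>Q. Pow I). F (\<lambda>q\<in>Q. if q \<in> A then insert j (T q) else T q))"
proof -
  have "(\<Sum>T\<in>(\<Pi>\<^sub>E q\<in>Q. Pow (insert j I)). F T) =
    (\<Sum>(A, T)\<in>Pow Q \<times> (\<Pi>\<^sub>E q\<in>Q. Pow I). F (\<lambda>q\<in>Q. if q \<in> A then insert j (T q) else T q))"
    unfolding case_prod_beta
  proof (rule sum.reindex_bij_witness
      [of _ "\<lambda>p. \<lambda>q\<in>Q. if q \<in> fst p then insert j (snd p q) else snd p q"
        "\<lambda>T. ({q\<in>Q. j \<in> T q}, \<lambda>q\<in>Q. T q - {j})"], goal_cases)
    case (1 T)
    then show ?case by (auto simp: fun_eq_iff PiE_iff extensional_def)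
  next
    case (2 T)
    then show ?case by (auto simp: PiE_iff)
  next
    case (3 p)
    obtain A T where p: "p = (A, T)" by (cases p)
    have A: "A \<subseteq> Q" and T: "T \<in> (\<Pi>\<^sub>E q\<in>Q. Pow I)" using 3 p by auto
    have j: "j \<notin> T q" if "q \<in> Q" for q using T that I by (auto simp: PiE_iff)
    have "(\<lambda>q\<in>Q. (\<lambda>q\<in>Q. if q \<in> A then insert j (T q) else T q) q - {j}) = T"
    proof
      fix q
      show "(\<lambda>q\<in>Q. (\<lambda>q\<in>Q. if q \<in> A then insert j (T q) else T q) q - {j}) q = T q"
        using j[of q] T by (cases "q \<in> Q") (auto simp: PiE_iff extensional_def)
    qed
    moreover have "{q \<in> Q. j \<in> (\<lambda>q\<in>Q. if q \<in> A then insert j (T q) else T q) q} = A"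
      using A j by auto
    ultimately show ?case unfolding p fst_conv snd_conv by simp
  next
    case (4 p)
    then show ?case by (auto simp: PiE_iff split: if_splits dest!: bspec)
  next
    case (5 T)
    have "(\<lambda>q\<in>Q. if q \<in> {q\<in>Q. j \<in> T q} then insert j ((\<lambda>q\<in>Q. T q - {j}) q) else (\<lambda>q\<in>Q. T q - {j}) q) = T"
    proof
      fix q
      show "(\<lambda>q\<in>Q. if q \<in> {q\<in>Q. j \<in> T q} then insert j ((\<lambda>q\<in>Q. T q - {j}) q) else (\<lambda>q\<in>Q. T q - {j}) q) q = T q"
        using 5 by (cases "q \<in> Q") (auto simp: PiE_iff extensional_def)
    qed
    then show ?case by (simp only: fst_conv snd_conv)
  qed
  then show ?thesis by (simp add: sum.cartesian_product)
qed

text \<open>A hypercontractive estimate in combinatorial form: \<theta> acts as a noise rate and the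
  right side is a product of L2 norms. Once the set \<open>A\<close> of members containing
  \<open>j\<close> is fixed, the sum over the other coordinates has the same form for the restricted
  coefficients \<open>b A\<close>; \<open>single_coordinate_bound\<close> recombines the norms of
  the two restrictions.\<close>

lemma covering_sum_bound:
  fixes a :: "'q \<Rightarrow> 'i set \<Rightarrow> real" and \<theta> :: real
  assumes Q: "finite Q" and I: "finite I" and a: "\<And>q T. a q T \<ge> 0"
    and \<theta>: "\<theta> = 1 / 2 ^ Suc (card Q)"
  shows "(\<Sum>T\<in>(\<Pi>\<^sub>E q\<in>Q. Pow I). (\<Prod>j\<in>I. of_bool (card {q\<in>Q. j \<in> T q} \<noteq> 1)) *
      (\<Prod>q\<in>Q. \<theta> ^ card (T q) * a q (T q))) \<le> (\<Prod>q\<in>Q. sqrt (\<Sum>T\<in>Pow I. (a q T)\<^sup>2))"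
  using I a
proof (induction I arbitrary: a rule: finite_induct)
  case empty
  have "(\<Pi>\<^sub>E q\<in>Q. Pow ({}::'i set)) = {\<lambda>q\<in>Q. {}}" by (simp add: PiE_singleton restrict_def)
  then show ?case using empty by simp
next
  case (insert j I)
  define b where "b A q T = (if q \<in> A then a q (insert j T) else a q T)" for A q T
  define \<Phi> where "\<Phi> a = (\<Sum>T\<in>(\<Pi>\<^sub>E q\<in>Q. Pow I). (\<Prod>j\<in>I. of_bool (card {q\<in>Q. j \<in> T q} \<noteq> 1)) *
      (\<Prod>q\<in>Q. \<theta> ^ card (T q) * a q (T q)))" for a
  have \<theta>0: "\<theta> \<ge> 0" by (simp add: \<theta>)
  have "(\<Sum>T\<in>(\<Pi>\<^sub>E q\<in>Q. Pow (insert j I)). (\<Prod>j\<in>insert j I. of_bool (card {q\<in>Q. j \<in> T q} \<noteq> 1)) *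
      (\<Prod>q\<in>Q. \<theta> ^ card (T q) * a q (T q))) =
      (\<Sum>A\<in>Pow Q. \<Sum>T\<in>(\<Pi>\<^sub>E q\<in>Q. Pow I). of_bool (card A \<noteq> 1) * \<theta> ^ card A *
       ((\<Prod>j\<in>I. of_bool (card {q\<in>Q. j \<in> T q} \<noteq> 1)) *
      (\<Prod>q\<in>Q. \<theta> ^ card (T q) * b A q (T q))))"
    unfolding PiE_Pow_insert_sum[OF Q insert.hyps]
  proof (intro sum.cong refl, goal_cases)
    case (1 A T)
    define U where "U = (\<lambda>q\<in>Q. if q \<in> A then insert j (T q) else T q)"
    have TI: "T q \<subseteq> I" if "q \<in> Q" for q using 1 that by (auto simp: PiE_iff)
    have jT: "j \<notin> T q" if "q \<in> Q" for q using TI[OF that] insert.hyps by auto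
    have fT: "finite (T q)" if "q \<in> Q" for q using TI[OF that] insert.hyps by (auto intro: finite_subset)
    have cA: "{q\<in>Q. j \<in> U q} = A" using 1 jT by (auto simp: U_def)
    have cI: "{q\<in>Q. i \<in> U q} = {q\<in>Q. i \<in> T q}" if "i \<in> I" for i
      using that insert.hyps by (auto simp: U_def)
    have "(\<Prod>q\<in>Q. \<theta> ^ card (U q) * a q (U q)) =
        (\<Prod>q\<in>Q. (if q \<in> A then \<theta> else 1) * (\<theta> ^ card (T q) * b A q (T q)))"
      by (intro prod.cong refl) (auto simp: U_def b_def jT fT)
    also have "\<dots> = (\<Prod>q\<in>Q. if q \<in> A then \<theta> else 1) * (\<Prod>q\<in>Q. \<theta> ^ card (T q) * b A q (T q))"
      by (simp add: prod.distrib)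
    also have "(\<Prod>q\<in>Q. if q \<in> A then \<theta> else 1) = \<theta> ^ card A"
      using 1 Q by (simp add: prod.If_cases Int_absorb1)
    finally have p: "(\<Prod>q\<in>Q. \<theta> ^ card (U q) * a q (U q)) = \<theta> ^ card A * (\<Prod>q\<in>Q. \<theta> ^ card (T q) * b A q (T q))" .
    show ?case unfolding U_def[symmetric]
      using insert.hyps cI by (simp add: cA p del: of_bool_not_iff)
  qed
  also have "\<dots> = (\<Sum>A\<in>Pow Q. of_bool (card A \<noteq> 1) * \<theta> ^ card A * \<Phi> (b A))"
    unfolding \<Phi>_def by (simp add: sum_distrib_left)
  also have "\<dots> \<le> (\<Sum>A\<in>Pow Q. of_bool (card A \<noteq> 1) * \<theta> ^ card A * (\<Prod>q\<in>Q. sqrt (\<Sum>T\<in>Pow I. (b A q T)\<^sup>2)))"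
    unfolding \<Phi>_def using \<theta>0
    by (intro sum_mono mult_left_mono insert.IH) (auto simp: b_def insert.prems)
  also have "\<dots> = (\<Sum>A\<in>Pow Q. of_bool (card A \<noteq> 1) * \<theta> ^ card A *
      ((\<Prod>q\<in>A. sqrt (\<Sum>T\<in>Pow I. (a q (insert j T))\<^sup>2)) * (\<Prod>q\<in>Q-A. sqrt (\<Sum>T\<in>Pow I. (a q T)\<^sup>2))))"
  proof (intro sum.cong refl, goal_cases)
    case (1 A)
    then have "(\<Prod>q\<in>Q. sqrt (\<Sum>T\<in>Pow I. (b A q T)\<^sup>2)) =
      (\<Prod>q\<in>Q. if q \<in> A then sqrt (\<Sum>T\<in>Pow I. (a q (insert j T))\<^sup>2) else sqrt (\<Sum>T\<in>Pow I. (a q T)\<^sup>2))"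
      by (intro prod.cong) (auto simp: b_def)
    also have "\<dots> = (\<Prod>q\<in>A. sqrt (\<Sum>T\<in>Pow I. (a q (insert j T))\<^sup>2)) * (\<Prod>q\<in>Q-A. sqrt (\<Sum>T\<in>Pow I. (a q T)\<^sup>2))"
      using Q 1 by (simp add: prod.If_cases Int_absorb1 Diff_eq)
    finally show ?case by simp
  qed
  also have "\<dots> \<le> (\<Prod>q\<in>Q. sqrt ((sqrt (\<Sum>T\<in>Pow I. (a q T)\<^sup>2))\<^sup>2 + (sqrt (\<Sum>T\<in>Pow I. (a q (insert j T))\<^sup>2))\<^sup>2))"
    by (rule single_coordinate_bound[OF Q _ _ \<theta>]) (auto intro: sum_nonneg)
  also have "\<dots> = (\<Prod>q\<in>Q. sqrt (\<Sum>T\<in>Pow (insert j I). (a q T)\<^sup>2))"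
  proof (intro prod.cong refl, goal_cases)
    case (1 q)
    have "(\<Sum>T\<in>Pow (insert j I). (a q T)\<^sup>2) = (\<Sum>T\<in>Pow I. (a q T)\<^sup>2) + (\<Sum>T\<in>insert j ` Pow I. (a q T)\<^sup>2)"
      unfolding Pow_insert using insert.hyps by (intro sum.union_disjoint) auto
    also have "(\<Sum>T\<in>insert j ` Pow I. (a q T)\<^sup>2) = (\<Sum>T\<in>Pow I. (a q (insert j T))\<^sup>2)"
      using insert.hyps by (subst sum.reindex) (auto simp: inj_on_def)
    finally show ?case by (simp add: sum_nonneg)
  qed
  finally show ?case .
qed

section \<open>Products of multilinear polynomials at independent columns\<close>

definition multilinear :: "'i set \<Rightarrow> ('i set \<Rightarrow> real) \<Rightarrow> ('i \<Rightarrow> real) \<Rightarrow> real" where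
  "multilinear I c x = (\<Sum>T\<in>Pow I. c T * (\<Prod>i\<in>T. x i))"

text \<open>The columns \<open>Y j\<close> are independent copies of \<mu>. What is returned are the
  rows \<open>X i\<close>, which are the queries and in general depend on each other. The
  restriction to \<open>I\<close> makes each row an extensional point of the cube.\<close>

definition iid_rows :: "'i set \<Rightarrow> ('k \<Rightarrow> real) pmf \<Rightarrow> ('k \<Rightarrow> 'i \<Rightarrow> real) pmf" where
  "iid_rows I \<mu> = map_pmf (\<lambda>Y i. \<lambda>j\<in>I. Y j i) (Pi_pmf I undefined (\<lambda>_. \<mu>))"

definition centered :: "('k \<Rightarrow> real) pmf \<Rightarrow> bool" where
  "centered \<mu> \<longleftrightarrow> set_pmf \<mu> \<subseteq> cube UNIV \<and> (\<forall>i. measure_pmf.expectation \<mu> (\<lambda>x. x i) = 0)"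

text \<open>On characters of size at most \<open>d q\<close>, the weight
  \<open>\<theta> ^ card T\<close> of \<open>covering_sum_bound\<close> is at least
  \<open>\<theta> ^ d q\<close>; compensating for it costs the power of \<open>1 / \<theta>\<close>
  in the conclusion.\<close>

lemma low_degree_covering_bound:
  fixes c :: "'q \<Rightarrow> 'i set \<Rightarrow> real"
  assumes Q: "finite Q" and I: "finite I"
    and d: "\<And>q T. q \<in> Q \<Longrightarrow> T \<subseteq> I \<Longrightarrow> c q T \<noteq> 0 \<Longrightarrow> card T \<le> d q"
  shows "(\<Sum>T\<in>(\<Pi>\<^sub>E q\<in>Q. Pow I). (\<Prod>j\<in>I. of_bool (card {q\<in>Q. j \<in> T q} \<noteq> 1)) *
      (\<Prod>q\<in>Q. \<bar>c q (T q)\<bar>)) \<le> (\<Prod>q\<in>Q. (2 ^ Suc (card Q)) ^ d q * sqrt (\<Sum>T\<in>Pow I. (c q T)\<^sup>2))"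
proof -
  define \<theta> :: real where "\<theta> = 1 / 2 ^ Suc (card Q)"
  define C :: real where "C = 2 ^ Suc (card Q)"
  have C1: "C \<ge> 1" unfolding C_def by (rule one_le_power) simp
  have \<theta>C: "\<theta> * C = 1" by (simp add: \<theta>_def C_def)
  have \<theta>0: "\<theta> > 0" by (simp add: \<theta>_def)
  have "(\<Sum>T\<in>(\<Pi>\<^sub>E q\<in>Q. Pow I). (\<Prod>j\<in>I. of_bool (card {q\<in>Q. j \<in> T q} \<noteq> 1)) *
      (\<Prod>q\<in>Q. \<bar>c q (T q)\<bar>)) \<le> (\<Sum>T\<in>(\<Pi>\<^sub>E q\<in>Q. Pow I). (\<Prod>j\<in>I. of_bool (card {q\<in>Q. j \<in> T q} \<noteq> 1)) *
      (\<Prod>q\<in>Q. \<theta> ^ card (T q) * (C ^ d q * \<bar>c q (T q)\<bar>)))"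
  proof (intro sum_mono mult_left_mono prod_mono conjI, goal_cases)
    case (2 T q)
    have "\<bar>c q (T q)\<bar> = (\<theta> * C) ^ card (T q) * \<bar>c q (T q)\<bar>" by (simp add: \<theta>C)
    also have "\<dots> = \<theta> ^ card (T q) * (C ^ card (T q) * \<bar>c q (T q)\<bar>)"
      by (simp add: power_mult_distrib)
    also have "\<dots> \<le> \<theta> ^ card (T q) * (C ^ d q * \<bar>c q (T q)\<bar>)"
    proof (cases "c q (T q) = 0")
      case False
      then have "card (T q) \<le> d q" using d[of q "T q"] 2 by (auto simp: PiE_iff)
      then show ?thesis using C1 \<theta>0 by (intro mult_left_mono mult_right_mono power_increasing) auto
    qed simp
    finally show ?case .
  qed (auto intro: prod_nonneg)
  also have "\<dots> \<le> (\<Prod>q\<in>Q. sqrt (\<Sum>T\<in>Pow I. (C ^ d q * \<bar>c q T\<bar>)\<^sup>2))"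
    using C1 by (intro covering_sum_bound[OF Q I _ \<theta>_def]) auto
  also have "\<dots> = (\<Prod>q\<in>Q. C ^ d q * sqrt (\<Sum>T\<in>Pow I. (c q T)\<^sup>2))"
  proof (intro prod.cong refl)
    fix q
    have "(\<Sum>T\<in>Pow I. (C ^ d q * \<bar>c q T\<bar>)\<^sup>2) = (C ^ d q)\<^sup>2 * (\<Sum>T\<in>Pow I. (c q T)\<^sup>2)"
      by (simp add: power_mult_distrib sum_distrib_left)
    then show "sqrt (\<Sum>T\<in>Pow I. (C ^ d q * \<bar>c q T\<bar>)\<^sup>2) = C ^ d q * sqrt (\<Sum>T\<in>Pow I. (c q T)\<^sup>2)"
      using C1 by (simp add: real_sqrt_mult)
  qed
  finally show ?thesis unfolding C_def .
qed

section \<open>Moments of queries with independent columns\<close>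

lemma iid_rows_in_cube:
  assumes "finite I" "set_pmf \<mu> \<subseteq> cube UNIV" "X \<in> set_pmf (iid_rows I \<mu>)"
  shows "X i \<in> cube I"
proof -
  obtain Y where Y: "Y \<in> set_pmf (Pi_pmf I undefined (\<lambda>_. \<mu>))" "X = (\<lambda>i. \<lambda>j\<in>I. Y j i)"
    using assms(3) by (auto simp: iid_rows_def)
  have "Y j \<in> set_pmf \<mu>" if "j \<in> I" for j
    using set_Pi_pmf[OF assms(1), of undefined "\<lambda>_. \<mu>"] Y(1) that by (auto simp: PiE_dflt_def)
  then have "Y j i \<in> {-1, 1}" if "j \<in> I" for j
    using assms(2) cube_range[of "Y j" UNIV i] that by auto
  then show ?thesis unfolding Y(2) cube_def by auto
qed

lemma finite_set_iid_rows:
  fixes \<mu> :: "('k::finite \<Rightarrow> real) pmf"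
  assumes "finite I" "set_pmf \<mu> \<subseteq> cube UNIV"
  shows "finite (set_pmf (iid_rows I \<mu>))"
proof (rule finite_subset)
  show "set_pmf (iid_rows I \<mu>) \<subseteq> (\<Pi>\<^sub>E i\<in>UNIV. cube I)"
    using iid_rows_in_cube[OF assms] by auto
  show "finite (\<Pi>\<^sub>E i\<in>(UNIV::'k set). cube I)"
    using finite_cube[OF assms(1)] by (intro finite_PiE) auto
qed

lemma finite_set_cube_pmf:
  fixes \<mu> :: "('k::finite \<Rightarrow> real) pmf"
  shows "set_pmf \<mu> \<subseteq> cube UNIV \<Longrightarrow> finite (set_pmf \<mu>)"
  using finite_cube[of "UNIV::'k set"] by (auto intro: finite_subset)

lemma expectation_prod_Pi_pmf_finite:
  fixes g :: "'i \<Rightarrow> 'a \<Rightarrow> real"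
  assumes I: "finite I" and p: "finite (set_pmf p)"
  shows "measure_pmf.expectation (Pi_pmf I d (\<lambda>_. p)) (\<lambda>Y. \<Prod>j\<in>I. g j (Y j)) =
    (\<Prod>j\<in>I. measure_pmf.expectation p (g j))"
proof -
  let ?M = "measure_pmf (Pi_pmf I d (\<lambda>_. p))"
  have comp: "map_pmf (\<lambda>Y. Y j) (Pi_pmf I d (\<lambda>_. p)) = p" if "j \<in> I" for j
    using that I by (simp add: Pi_pmf_component)
  have fin: "finite (set_pmf (Pi_pmf I d (\<lambda>_. p)))"
    using I p by (simp add: set_Pi_pmf finite_PiE_dflt)
  have "measure_pmf.expectation (Pi_pmf I d (\<lambda>_. p)) (\<lambda>Y. \<Prod>j\<in>I. g j (Y j)) =
      (\<Prod>j\<in>I. measure_pmf.expectation (Pi_pmf I d (\<lambda>_. p)) (\<lambda>Y. g j (Y j)))"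
  proof (rule prob_space.indep_vars_lebesgue_integral[OF measure_pmf.prob_space_axioms I])
    show "prob_space.indep_vars (Pi_pmf I d (\<lambda>_. p)) (\<lambda>_. borel) (\<lambda>j Y. g j (Y j)) I"
      using prob_space.indep_vars_compose2[OF measure_pmf.prob_space_axioms indep_vars_Pi_pmf[OF I], of g "\<lambda>_. borel"] by simp
  qed (intro integrable_measure_pmf_finite fin)
  also have "\<dots> = (\<Prod>j\<in>I. measure_pmf.expectation p (g j))"
  proof (intro prod.cong refl)
    fix j assume "j \<in> I"
    show "measure_pmf.expectation (Pi_pmf I d (\<lambda>_. p)) (\<lambda>Y. g j (Y j)) = measure_pmf.expectation p (g j)"
      by (subst (2) comp[OF \<open>j \<in> I\<close>, symmetric]) simp
  qed
  finally show ?thesis .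
qed

lemma expectation_iid_rows_prod:
  fixes \<mu> :: "('k::finite \<Rightarrow> real) pmf" and g :: "'i \<Rightarrow> ('k \<Rightarrow> real) \<Rightarrow> real"
  assumes I: "finite I" and \<mu>: "set_pmf \<mu> \<subseteq> cube UNIV"
  shows "measure_pmf.expectation (iid_rows I \<mu>) (\<lambda>X. \<Prod>j\<in>I. g j (\<lambda>i. X i j)) =
    (\<Prod>j\<in>I. measure_pmf.expectation \<mu> (g j))"
proof -
  have "measure_pmf.expectation (iid_rows I \<mu>) (\<lambda>X. \<Prod>j\<in>I. g j (\<lambda>i. X i j)) =
    measure_pmf.expectation (Pi_pmf I undefined (\<lambda>_. \<mu>)) (\<lambda>Y. \<Prod>j\<in>I. g j (Y j))"
    unfolding iid_rows_def by simp
  also have "\<dots> = (\<Prod>j\<in>I. measure_pmf.expectation \<mu> (g j))"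
    by (rule expectation_prod_Pi_pmf_finite[OF I finite_set_cube_pmf[OF \<mu>]])
  finally show ?thesis .
qed

text \<open>Independence of the columns turns the product over members into a product over
  coordinates. The map \<open>\<phi>\<close> from indices to queries may repeat a query, which later
  lets the square of a product be treated as a product.\<close>

lemma expectation_iid_rows_monomial:
  fixes \<mu> :: "('k::finite \<Rightarrow> real) pmf" and T :: "'q \<Rightarrow> 'i set"
  assumes I: "finite I" and \<mu>: "set_pmf \<mu> \<subseteq> cube UNIV" and Q: "finite Q"
    and T: "\<And>q. q \<in> Q \<Longrightarrow> T q \<subseteq> I"
  shows "measure_pmf.expectation (iid_rows I \<mu>) (\<lambda>X. \<Prod>q\<in>Q. \<Prod>j\<in>T q. X (\<phi> q) j) =
    (\<Prod>j\<in>I. measure_pmf.expectation \<mu> (\<lambda>x. \<Prod>q\<in>{q\<in>Q. j \<in> T q}. x (\<phi> q)))"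
proof -
  have "(\<Prod>q\<in>Q. \<Prod>j\<in>T q. X (\<phi> q) j) = (\<Prod>j\<in>I. \<Prod>q\<in>{q\<in>Q. j \<in> T q}. X (\<phi> q) j)"
    for X :: "'k \<Rightarrow> 'i \<Rightarrow> real"
  proof -
    have "(\<Prod>q\<in>Q. \<Prod>j\<in>T q. X (\<phi> q) j) = (\<Prod>q\<in>Q. \<Prod>j\<in>{j\<in>I. j \<in> T q}. X (\<phi> q) j)"
      using T by (intro prod.cong) auto
    also have "\<dots> = (\<Prod>j\<in>I. \<Prod>q\<in>{q\<in>Q. j \<in> T q}. X (\<phi> q) j)"
      using Q I by (rule prod.swap_restrict)
    finally show ?thesis .
  qed
  then show ?thesis
    using expectation_iid_rows_prod[OF I \<mu>, of "\<lambda>j x. \<Prod>q\<in>{q\<in>Q. j \<in> T q}. x (\<phi> q)"] by simp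
qed

lemma expectation_iid_rows_multilinear:
  fixes \<mu> :: "('k::finite \<Rightarrow> real) pmf" and c :: "'q \<Rightarrow> 'i set \<Rightarrow> real"
  assumes I: "finite I" and \<mu>: "set_pmf \<mu> \<subseteq> cube UNIV" and Q: "finite Q"
  shows "measure_pmf.expectation (iid_rows I \<mu>) (\<lambda>X. \<Prod>q\<in>Q. multilinear I (c q) (X (\<phi> q))) =
    (\<Sum>T\<in>(\<Pi>\<^sub>E q\<in>Q. Pow I). (\<Prod>q\<in>Q. c q (T q)) *
      (\<Prod>j\<in>I. measure_pmf.expectation \<mu> (\<lambda>x. \<Prod>q\<in>{q\<in>Q. j \<in> T q}. x (\<phi> q))))"
proof -
  have int: "integrable (measure_pmf (iid_rows I \<mu>)) h" for h :: "_ \<Rightarrow> real"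
    by (intro integrable_measure_pmf_finite finite_set_iid_rows I \<mu>)
  have "(\<Prod>q\<in>Q. multilinear I (c q) (X (\<phi> q))) =
      (\<Sum>T\<in>(\<Pi>\<^sub>E q\<in>Q. Pow I). (\<Prod>q\<in>Q. c q (T q)) * (\<Prod>q\<in>Q. \<Prod>j\<in>T q. X (\<phi> q) j))"
    for X :: "'k \<Rightarrow> 'i \<Rightarrow> real"
    unfolding multilinear_def using I Q by (subst prod_sum_PiE) (simp_all add: prod.distrib)
  then have "measure_pmf.expectation (iid_rows I \<mu>) (\<lambda>X. \<Prod>q\<in>Q. multilinear I (c q) (X (\<phi> q))) =
      (\<Sum>T\<in>(\<Pi>\<^sub>E q\<in>Q. Pow I). (\<Prod>q\<in>Q. c q (T q)) *
      measure_pmf.expectation (iid_rows I \<mu>) (\<lambda>X. \<Prod>q\<in>Q. \<Prod>j\<in>T q. X (\<phi> q) j))"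
    by (simp add: Bochner_Integration.integral_sum int)
  also have "\<dots> = (\<Sum>T\<in>(\<Pi>\<^sub>E q\<in>Q. Pow I). (\<Prod>q\<in>Q. c q (T q)) *
      (\<Prod>j\<in>I. measure_pmf.expectation \<mu> (\<lambda>x. \<Prod>q\<in>{q\<in>Q. j \<in> T q}. x (\<phi> q))))"
    by (intro sum.cong refl arg_cong2[of _ _ _ _ "(*)"] expectation_iid_rows_monomial I \<mu> Q)
      (auto simp: PiE_iff)
  finally show ?thesis .
qed

lemma abs_expectation_pmf_le:
  fixes g :: "'a \<Rightarrow> real"
  assumes "\<And>x. x \<in> set_pmf p \<Longrightarrow> \<bar>g x\<bar> \<le> B"
  shows "\<bar>measure_pmf.expectation p g\<bar> \<le> B"
proof -
  have B: "0 \<le> B" using assms set_pmf_not_empty[of p] by (meson abs_ge_zero ex_in_conv order_trans)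
  have "norm (measure_pmf.expectation p g) \<le> measure_pmf.expectation p (\<lambda>x. norm (g x))"
    by (rule integral_norm_bound)
  also have "\<dots> \<le> measure_pmf.expectation p (\<lambda>x. B)"
    using assms B by (intro integral_mono_AE')(auto simp: AE_measure_pmf_iff)
  finally show ?thesis by simp
qed

lemma abs_moment_le:
  assumes "set_pmf \<mu> \<subseteq> cube UNIV"
  shows "\<bar>measure_pmf.expectation \<mu> (\<lambda>x. \<Prod>q\<in>A. x (\<phi> q))\<bar> \<le> 1"
proof (rule abs_expectation_pmf_le)
  fix x assume "x \<in> set_pmf \<mu>"
  then have "\<bar>x i\<bar> = 1" for i using assms cube_range[of x UNIV i] by fastforce
  then show "\<bar>\<Prod>q\<in>A. x (\<phi> q)\<bar> \<le> 1" by (simp add: abs_prod)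
qed

text \<open>Centering kills the singleton moments. This is what brings the families covering no
  point exactly once into play.\<close>

lemma abs_moment_le_covering:
  assumes "centered \<mu>"
  shows "\<bar>measure_pmf.expectation \<mu> (\<lambda>x. \<Prod>q\<in>A. x (\<phi> q))\<bar> \<le> of_bool (card A \<noteq> 1)"
proof (cases "card A = 1")
  case True
  then obtain a where "A = {a}" by (auto simp: card_1_singleton_iff)
  then show ?thesis using assms by (simp add: centered_def)
next
  case False
  then show ?thesis using assms abs_moment_le[of \<mu>] by (simp add: centered_def)
qed

text \<open>The bound depends neither on \<mu> nor on the size of \<open>I\<close>. It does the work
  of hypercontractivity for products of low-degree polynomials at correlated queries.\<close>

lemma abs_expectation_iid_rows_multilinear_le:
  fixes \<mu> :: "('k::finite \<Rightarrow> real) pmf" and c :: "'q \<Rightarrow> 'i set \<Rightarrow> real"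
  assumes I: "finite I" and \<mu>: "centered \<mu>" and Q: "finite Q"
    and d: "\<And>q T. q \<in> Q \<Longrightarrow> T \<subseteq> I \<Longrightarrow> c q T \<noteq> 0 \<Longrightarrow> card T \<le> d q"
  shows "\<bar>measure_pmf.expectation (iid_rows I \<mu>) (\<lambda>X. \<Prod>q\<in>Q. multilinear I (c q) (X (\<phi> q)))\<bar> \<le>
    (\<Prod>q\<in>Q. (2 ^ Suc (card Q)) ^ d q * sqrt (\<Sum>T\<in>Pow I. (c q T)\<^sup>2))"
proof -
  have "\<bar>measure_pmf.expectation (iid_rows I \<mu>) (\<lambda>X. \<Prod>q\<in>Q. multilinear I (c q) (X (\<phi> q)))\<bar> \<le>
     (\<Sum>T\<in>(\<Pi>\<^sub>E q\<in>Q. Pow I). \<bar>(\<Prod>q\<in>Q. c q (T q)) *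
      (\<Prod>j\<in>I. measure_pmf.expectation \<mu> (\<lambda>x. \<Prod>q\<in>{q\<in>Q. j \<in> T q}. x (\<phi> q)))\<bar>)"
    using \<mu> by (subst expectation_iid_rows_multilinear[OF I _ Q]) (auto simp: centered_def)
  also have "\<dots> \<le> (\<Sum>T\<in>(\<Pi>\<^sub>E q\<in>Q. Pow I). (\<Prod>j\<in>I. of_bool (card {q\<in>Q. j \<in> T q} \<noteq> 1)) *
      (\<Prod>q\<in>Q. \<bar>c q (T q)\<bar>))"
    unfolding abs_mult abs_prod
    by (subst mult.commute, intro sum_mono mult_right_mono prod_mono conjI abs_moment_le_covering \<mu>)
      (auto intro: prod_nonneg)
  also have "\<dots> \<le> (\<Prod>q\<in>Q. (2 ^ Suc (card Q)) ^ d q * sqrt (\<Sum>T\<in>Pow I. (c q T)\<^sup>2))"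
    by (rule low_degree_covering_bound[OF Q I d])
  finally show ?thesis .
qed

text \<open>Under a centered distribution every single row is uniform on the cube, so this is
  Parseval's identity.\<close>

lemma expectation_iid_rows_multilinear_square:
  fixes \<mu> :: "('k::finite \<Rightarrow> real) pmf"
  assumes I: "finite I" and \<mu>: "centered \<mu>"
  shows "measure_pmf.expectation (iid_rows I \<mu>) (\<lambda>X. (multilinear I c (X i))\<^sup>2) = (\<Sum>T\<in>Pow I. (c T)\<^sup>2)"
proof -
  have \<mu>c: "set_pmf \<mu> \<subseteq> cube UNIV" using \<mu> by (simp add: centered_def)
  have int: "integrable (measure_pmf (iid_rows I \<mu>)) h" for h :: "_ \<Rightarrow> real"
    by (intro integrable_measure_pmf_finite finite_set_iid_rows I \<mu>c)
  have orth: "measure_pmf.expectation (iid_rows I \<mu>) (\<lambda>X. (\<Prod>j\<in>T. X i j) * (\<Prod>j\<in>U. X i j)) = of_bool (U = T)"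
    if T: "T \<subseteq> I" and U: "U \<subseteq> I" for T U
  proof -
    have "measure_pmf.expectation (iid_rows I \<mu>) (\<lambda>X. (\<Prod>j\<in>T. X i j) * (\<Prod>j\<in>U. X i j)) =
      measure_pmf.expectation (iid_rows I \<mu>) (\<lambda>X. \<Prod>j\<in>I. (if j \<in> T then X i j else 1) * (if j \<in> U then X i j else 1))"
      using T U I by (simp add: prod.distrib prod.If_cases Int_absorb1)
    also have "\<dots> = (\<Prod>j\<in>I. measure_pmf.expectation \<mu> (\<lambda>x. (if j \<in> T then x i else 1) * (if j \<in> U then x i else 1)))"
      by (rule expectation_iid_rows_prod[OF I \<mu>c])
    also have "\<dots> = (\<Prod>j\<in>I. of_bool (j \<in> U \<longleftrightarrow> j \<in> T))"
    proof (intro prod.cong refl)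
      fix j
      have "measure_pmf.expectation \<mu> (\<lambda>x. x i * x i) = measure_pmf.expectation \<mu> (\<lambda>x. 1)"
        using \<mu>c cube_range[of _ UNIV i] by (intro integral_cong_AE) (force simp: AE_measure_pmf_iff)+
      then show "measure_pmf.expectation \<mu> (\<lambda>x. (if j \<in> T then x i else 1) * (if j \<in> U then x i else 1)) =
        of_bool (j \<in> U \<longleftrightarrow> j \<in> T)"
        using \<mu> by (auto simp: centered_def)
    qed
    also have "\<dots> = of_bool (U = T)"
      using I T U by (cases "U = T") (auto intro!: prod_zero)
    finally show ?thesis .
  qed
  have "(multilinear I c (X i))\<^sup>2 =
      (\<Sum>T\<in>Pow I. \<Sum>U\<in>Pow I. c T * c U * ((\<Prod>j\<in>T. X i j) * (\<Prod>j\<in>U. X i j)))"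
    for X :: "'k \<Rightarrow> 'a \<Rightarrow> real"
    unfolding multilinear_def power2_eq_square sum_product
    by (intro sum.cong refl) (simp only: mult_ac)
  then have "measure_pmf.expectation (iid_rows I \<mu>) (\<lambda>X. (multilinear I c (X i))\<^sup>2) =
    (\<Sum>T\<in>Pow I. \<Sum>U\<in>Pow I. c T * c U *
      measure_pmf.expectation (iid_rows I \<mu>) (\<lambda>X. (\<Prod>j\<in>T. X i j) * (\<Prod>j\<in>U. X i j)))"
    by (simp add: Bochner_Integration.integral_sum int)
  also have "\<dots> = (\<Sum>T\<in>Pow I. \<Sum>U\<in>Pow I. if U = T then c T * c U else 0)"
    by (intro sum.cong refl) (auto simp: orth)
  also have "\<dots> = (\<Sum>T\<in>Pow I. (c T)\<^sup>2)"
    using I by (simp add: power2_eq_square)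
  finally show ?thesis .
qed

section \<open>Boundedness, Bessel's inequality and parity for Fourier expansions\<close>

text \<open>For \<open>z\<close> with entries in [-1,1], the weights are the probabilities of
  \<open>y\<close> under the product measure with mean \<open>z\<close>. So the extension is an
  average of \<open>f\<close>, which gives its boundedness below.\<close>

lemma multilinear_ext_eq_sum_cube:
  assumes I: "finite I"
  shows "multilinear_ext I f z = (\<Sum>y\<in>cube I. f y * (\<Prod>i\<in>I. (1 + y i * z i) / 2))"
proof -
  have "multilinear_ext I f z = (\<Sum>T\<in>Pow I. \<Sum>y\<in>cube I. f y * (\<Prod>i\<in>T. y i * z i) / 2 ^ card I)"
    unfolding multilinear_ext_def fourier_coeff_def
    by (simp add: sum_divide_distrib sum_distrib_right prod.distrib mult.assoc)
  also have "\<dots> = (\<Sum>y\<in>cube I. f y * (\<Sum>T\<in>Pow I. \<Prod>i\<in>T. y i * z i) / 2 ^ card I)"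
    by (subst sum.swap) (simp add: sum_divide_distrib sum_distrib_left)
  also have "\<dots> = (\<Sum>y\<in>cube I. f y * (\<Prod>i\<in>I. (1 + y i * z i) / 2))"
  proof (intro sum.cong refl)
    fix y :: "'a \<Rightarrow> real"
    have "(\<Sum>T\<in>Pow I. \<Prod>i\<in>T. y i * z i) = (\<Prod>i\<in>I. 1 + y i * z i)"
      using prod_add[OF I, of "\<lambda>i. y i * z i" "\<lambda>_. 1"] by (simp add: add.commute)
    then show "f y * (\<Sum>T\<in>Pow I. \<Prod>i\<in>T. y i * z i) / 2 ^ card I = f y * (\<Prod>i\<in>I. (1 + y i * z i) / 2)"
      by (simp add: prod_dividef)
  qed
  finally show ?thesis .
qed

lemma abs_multilinear_ext_le:
  assumes I: "finite I" and f: "\<And>y. y \<in> cube I \<Longrightarrow> \<bar>f y\<bar> \<le> 1"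
    and z: "\<And>i. i \<in> I \<Longrightarrow> \<bar>z i\<bar> \<le> 1"
  shows "\<bar>multilinear_ext I f z\<bar> \<le> 1"
proof -
  have nn: "(\<Prod>i\<in>I. (1 + y i * z i) / 2) \<ge> 0" if "y \<in> cube I" for y
    using cube_range[OF that] z by (intro prod_nonneg) (force simp: abs_le_iff)
  have "\<bar>multilinear_ext I f z\<bar> \<le> (\<Sum>y\<in>cube I. \<bar>f y * (\<Prod>i\<in>I. (1 + y i * z i) / 2)\<bar>)"
    unfolding multilinear_ext_eq_sum_cube[OF I] by (rule sum_abs)
  also have "\<dots> \<le> (\<Sum>y\<in>cube I. \<Prod>i\<in>I. (1 + y i * z i) / 2)"
    unfolding abs_mult by (intro sum_mono) (use f nn in \<open>auto intro!: mult_left_le_one_le\<close>)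
  also have "\<dots> = (\<Prod>i\<in>I. \<Sum>b\<in>{-1, 1}. (1 + b * z i) / 2)"
    unfolding cube_def using I by (subst prod_sum_PiE) auto
  also have "\<dots> = 1" by (simp add: field_simps)
  finally show ?thesis .
qed

text \<open>Unfolding one factor of each square leaves the average of \<open>f\<close> times its own
  expansion, which is the average of the square of \<open>f\<close>.\<close>

lemma sum_fourier_coeff_square_le:
  assumes I: "finite I" and f: "\<And>y. y \<in> cube I \<Longrightarrow> \<bar>f y\<bar> \<le> 1"
  shows "(\<Sum>T\<in>Pow I. (fourier_coeff I f T)\<^sup>2) \<le> 1"
proof -
  have "(\<Sum>T\<in>Pow I. (fourier_coeff I f T)\<^sup>2) =
    (\<Sum>T\<in>Pow I. \<Sum>x\<in>cube I. f x * (fourier_coeff I f T * (\<Prod>i\<in>T. x i)) / 2 ^ card I)"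
    by (intro sum.cong refl, subst power2_eq_square, subst (2) fourier_coeff_def)
      (simp add: sum_divide_distrib sum_distrib_left mult_ac)
  also have "\<dots> = (\<Sum>x\<in>cube I. f x * multilinear_ext I f x / 2 ^ card I)"
    by (subst sum.swap) (simp add: multilinear_ext_def sum_divide_distrib sum_distrib_left)
  also have "\<dots> \<le> (\<Sum>x\<in>cube I. 1 / 2 ^ card I)"
  proof (intro sum_mono divide_right_mono)
    fix x assume x: "x \<in> cube I"
    then have "f x * multilinear_ext I f x = \<bar>f x\<bar>\<^sup>2"
      using multilinear_ext_on_cube[OF I x] by (simp add: power2_eq_square)
    also have "\<dots> \<le> 1" using f[OF x] power_le_one[of "\<bar>f x\<bar>" 2] by simp
    finally show "f x * multilinear_ext I f x \<le> 1" .
  qed simp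
  also have "\<dots> = 1" using card_cube[OF I] by simp
  finally show ?thesis .
qed

lemma odd_function_fourier_coeff:
  assumes I: "finite I" and f: "odd_function I f" and T: "T \<subseteq> I" "even (card T)"
  shows "fourier_coeff I f T = 0"
proof -
  have inv: "antipode I (antipode I x) = x" and cl: "antipode I x \<in> cube I" if "x \<in> cube I" for x
    using that by (auto simp: antipode_def cube_def PiE_iff extensional_def fun_eq_iff)
  have "(\<Sum>x\<in>cube I. f x * (\<Prod>i\<in>T. x i)) = (\<Sum>x\<in>cube I. f (antipode I x) * (\<Prod>i\<in>T. antipode I x i))"
    by (rule sum.reindex_bij_witness[of _ "antipode I" "antipode I"])
      (auto simp: inv cl)
  also have "\<dots> = (\<Sum>x\<in>cube I. - (f x * (\<Prod>i\<in>T. x i)))"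
  proof (intro sum.cong refl)
    fix x assume x: "x \<in> cube I"
    have "(\<Prod>i\<in>T. antipode I x i) = (\<Prod>i\<in>T. - x i)"
      using T by (intro prod.cong) (auto simp: antipode_def)
    also have "\<dots> = (\<Prod>i\<in>T. x i)" using T(2) by (simp add: prod_uminus)
    finally show "f (antipode I x) * (\<Prod>i\<in>T. antipode I x i) = - (f x * (\<Prod>i\<in>T. x i))"
      using f x by (simp add: odd_function_def)
  qed
  finally show ?thesis by (simp add: fourier_coeff_def sum_negf)
qed

section \<open>Truncation and low-degree products\<close>

definition truncate :: "nat \<Rightarrow> ('i set \<Rightarrow> real) \<Rightarrow> 'i set \<Rightarrow> real" where
  "truncate d c T = (if card T \<le> d then c T else 0)"

text \<open>These are the properties of a noise-smoothed bounded function that truncation relies on.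
  The decay of the tail beyond degree \<open>d\<close> is uniform in the size of
  \<open>I\<close>.\<close>

definition smooth :: "real \<Rightarrow> 'i set \<Rightarrow> ('i set \<Rightarrow> real) \<Rightarrow> bool" where
  "smooth r I c \<longleftrightarrow> (\<forall>x\<in>cube I. \<bar>multilinear I c x\<bar> \<le> 1) \<and> (\<Sum>T\<in>Pow I. (c T)\<^sup>2) \<le> 1 \<and>
     (\<forall>d. (\<Sum>T\<in>Pow I. (c T - truncate d c T)\<^sup>2) \<le> r ^ d)"

lemma sum_truncate_square_le:
  assumes "(\<Sum>T\<in>Pow I. (c T)\<^sup>2) \<le> 1"
  shows "(\<Sum>T\<in>Pow I. (truncate d c T)\<^sup>2) \<le> 1"
proof -
  have "(\<Sum>T\<in>Pow I. (truncate d c T)\<^sup>2) \<le> (\<Sum>T\<in>Pow I. (c T)\<^sup>2)"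
    by (intro sum_mono) (auto simp: truncate_def)
  then show ?thesis using assms by simp
qed

lemma multilinear_diff: "multilinear I c x - multilinear I c' x = multilinear I (\<lambda>T. c T - c' T) x"
  by (simp add: multilinear_def sum_subtractf left_diff_distrib)

text \<open>Truncation destroys pointwise boundedness, so only moments of truncated products can be
  controlled. The index set \<open>A \<times> UNIV\<close> over the booleans takes each query twice
  and turns the square into a product.\<close>

lemma second_moment_truncated_le:
  fixes \<mu> :: "('k::finite \<Rightarrow> real) pmf" and A :: "'k set"
  assumes I: "finite I" and \<mu>: "centered \<mu>" and c: "\<And>i. (\<Sum>T\<in>Pow I. (c i T)\<^sup>2) \<le> 1"
  shows "measure_pmf.expectation (iid_rows I \<mu>) (\<lambda>X. (\<Prod>i\<in>A. multilinear I (truncate (d i) (c i)) (X i))\<^sup>2)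
    \<le> (\<Prod>p\<in>A \<times> (UNIV :: bool set). (2 ^ Suc (card (A \<times> (UNIV :: bool set)))) ^ d (fst p))"
proof -
  define Q where "Q = A \<times> (UNIV :: bool set)"
  have sq: "(\<Prod>i\<in>A. F i)\<^sup>2 = (\<Prod>p\<in>Q. F (fst p))" for F :: "'k \<Rightarrow> real"
  proof -
    have "(\<Prod>i\<in>A. F i)\<^sup>2 = (\<Prod>i\<in>A. \<Prod>b\<in>(UNIV::bool set). F i)"
      by (simp add: UNIV_bool power2_eq_square prod.distrib)
    also have "\<dots> = (\<Prod>p\<in>Q. F (fst p))"
      using prod.cartesian_product[of "\<lambda>i b. F i" "UNIV :: bool set" A]
      by (simp only: case_prod_unfold Q_def)
    finally show ?thesis .
  qed
  have "measure_pmf.expectation (iid_rows I \<mu>) (\<lambda>X. \<Prod>p\<in>Q. multilinear I (truncate (d (fst p)) (c (fst p))) (X (fst p)))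
    \<le> (\<Prod>p\<in>Q. (2 ^ Suc (card Q)) ^ d (fst p) * sqrt (\<Sum>T\<in>Pow I. (truncate (d (fst p)) (c (fst p)) T)\<^sup>2))"
    by (rule order_trans[OF abs_ge_self abs_expectation_iid_rows_multilinear_le[OF I \<mu>]])
      (auto simp: Q_def truncate_def split: if_splits)
  also have "\<dots> \<le> (\<Prod>p\<in>Q. (2 ^ Suc (card Q)) ^ d (fst p) * 1)"
    by (intro prod_mono conjI mult_left_mono mult_nonneg_nonneg)
      (auto intro!: sum_nonneg sum_truncate_square_le c)
  finally show ?thesis unfolding sq Q_def by simp
qed

text \<open>
  The factor \<open>W\<close> absorbs the factors not yet truncated. The degrees are chosen one after the
  other, each large enough to beat the second moment of the product truncated so far.
\<close>

lemma truncation: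
  fixes A :: "'k::finite set"
  assumes r: "0 \<le> r" "r < 1" and \<gamma>: "\<gamma> > 0"
  shows "\<exists>d::'k \<Rightarrow> nat. \<forall>(I::'i set) \<mu> c W. finite I \<longrightarrow> centered \<mu> \<longrightarrow> (\<forall>i. smooth r I (c i)) \<longrightarrow>
    (\<forall>X\<in>set_pmf (iid_rows I \<mu>). \<bar>W X\<bar> \<le> 1) \<longrightarrow>
    \<bar>measure_pmf.expectation (iid_rows I \<mu>) (\<lambda>X. W X * (\<Prod>i\<in>A. multilinear I (c i) (X i))) -
     measure_pmf.expectation (iid_rows I \<mu>) (\<lambda>X. W X * (\<Prod>i\<in>A. multilinear I (truncate (d i) (c i)) (X i)))\<bar> \<le> \<gamma>"
  using finite[of A] \<gamma>
proof (induction A arbitrary: \<gamma> rule: finite_induct)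
  case empty
  then show ?case by simp
next
  case (insert a A)
  have "\<gamma> / 2 > 0" using insert.prems by simp
  from insert.IH[OF this] obtain d where d: "\<And>(I::'i set) \<mu> c W. finite I \<Longrightarrow> centered \<mu> \<Longrightarrow> (\<And>i. smooth r I (c i)) \<Longrightarrow>
    (\<And>X. X\<in>set_pmf (iid_rows I \<mu>) \<Longrightarrow> \<bar>W X\<bar> \<le> 1) \<Longrightarrow>
    \<bar>measure_pmf.expectation (iid_rows I \<mu>) (\<lambda>X. W X * (\<Prod>i\<in>A. multilinear I (c i) (X i))) -
     measure_pmf.expectation (iid_rows I \<mu>) (\<lambda>X. W X * (\<Prod>i\<in>A. multilinear I (truncate (d i) (c i)) (X i)))\<bar> \<le> \<gamma> / 2"
    by meson
  define K :: real where "K = (\<Prod>p\<in>A \<times> (UNIV :: bool set). (2 ^ Suc (card (A \<times> (UNIV :: bool set)))) ^ d (fst p))"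
  \<comment> \<open>The weight in the AM-GM inequality applied below to \<open>L\<close> and
    \<open>h - h1\<close>. It is small enough that \<open>t * K\<close> stays below
    \<open>\<gamma> / 2\<close>; the degree \<open>n\<close> is then taken so large that the tail
    divided by \<open>t\<close> does too.\<close>
  define t where "t = \<gamma> / (2 * (K + 1))"
  have K0: "K \<ge> 0" unfolding K_def by (intro prod_nonneg) auto
  have t0: "t > 0" unfolding t_def using K0 insert.prems by simp
  have tK: "t * K \<le> \<gamma> / 2" unfolding t_def using K0 insert.prems by (simp add: field_simps)
  obtain n where n: "r ^ n < t * (\<gamma> / 2)"
    using real_arch_pow_inv[of "t * (\<gamma> / 2)" r] r t0 insert.prems by auto
  show ?case
  proof (intro exI[of _ "d(a := n)"] allI impI)
    fix I :: "'i set" and \<mu> :: "('k \<Rightarrow> real) pmf" and c :: "'k \<Rightarrow> 'i set \<Rightarrow> real" and W :: "('k \<Rightarrow> 'i \<Rightarrow> real) \<Rightarrow> real"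
    assume I: "finite I" and \<mu>: "centered \<mu>" and c: "\<forall>i. smooth r I (c i)"
      and W: "\<forall>X\<in>set_pmf (iid_rows I \<mu>). \<bar>W X\<bar> \<le> 1"
    let ?E = "measure_pmf.expectation (iid_rows I \<mu>)"
    have \<mu>c: "set_pmf \<mu> \<subseteq> cube UNIV" using \<mu> by (simp add: centered_def)
    have int: "integrable (measure_pmf (iid_rows I \<mu>)) h" for h :: "_ \<Rightarrow> real"
      by (intro integrable_measure_pmf_finite finite_set_iid_rows I \<mu>c)
    define L where "L X = (\<Prod>i\<in>A. multilinear I (truncate (d i) (c i)) (X i))" for X
    define h where "h X = multilinear I (c a) (X a)" for X :: "'k \<Rightarrow> 'i \<Rightarrow> real"
    define h1 where "h1 X = multilinear I (truncate n (c a)) (X a)" for X :: "'k \<Rightarrow> 'i \<Rightarrow> real"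
    \<comment> \<open>The factor at \<open>a\<close> joins the weight before it is truncated, while
      it is still bounded by 1; its truncation need not be. The induction hypothesis therefore
      applies with weight \<open>W * h\<close>.\<close>
    have Wh: "\<bar>W X * h X\<bar> \<le> 1" if "X \<in> set_pmf (iid_rows I \<mu>)" for X
    proof -
      have "\<bar>h X\<bar> \<le> 1" using c iid_rows_in_cube[OF I \<mu>c that] by (auto simp: h_def smooth_def)
      then show ?thesis using W that by (simp add: abs_mult mult_le_one)
    qed
    have 1: "\<bar>?E (\<lambda>X. (W X * h X) * (\<Prod>i\<in>A. multilinear I (c i) (X i))) - ?E (\<lambda>X. (W X * h X) * L X)\<bar> \<le> \<gamma> / 2"
      unfolding L_def using c by (intro d I \<mu> Wh) auto
    have L2: "?E (\<lambda>X. (L X)\<^sup>2) \<le> K"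
      unfolding L_def K_def using c by (intro second_moment_truncated_le I \<mu>) (auto simp: smooth_def)
    have "?E (\<lambda>X. (h X - h1 X)\<^sup>2) = (\<Sum>T\<in>Pow I. (c a T - truncate n (c a) T)\<^sup>2)"
      unfolding h_def h1_def multilinear_diff by (rule expectation_iid_rows_multilinear_square[OF I \<mu>])
    also have "\<dots> \<le> r ^ n" using c by (simp add: smooth_def)
    finally have H2: "?E (\<lambda>X. (h X - h1 X)\<^sup>2) \<le> t * (\<gamma> / 2)" using n by simp
    have "\<bar>?E (\<lambda>X. (W X * h X) * L X) - ?E (\<lambda>X. (W X * h1 X) * L X)\<bar> = \<bar>?E (\<lambda>X. W X * (L X * (h X - h1 X)))\<bar>"
      by (subst Bochner_Integration.integral_diff[symmetric]) (auto simp: int algebra_simps)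
    also have "\<dots> \<le> ?E (\<lambda>X. \<bar>W X * (L X * (h X - h1 X))\<bar>)"
      by (rule integral_abs_bound)
    also have "\<dots> \<le> ?E (\<lambda>X. (t * (L X)\<^sup>2 + (h X - h1 X)\<^sup>2 / t) / 2)"
    proof (intro integral_mono_AE int, unfold AE_measure_pmf_iff, intro ballI)
      fix X assume X: "X \<in> set_pmf (iid_rows I \<mu>)"
      define y where "y = h X - h1 X"
      have "0 \<le> (t * \<bar>L X\<bar> - \<bar>y\<bar>)\<^sup>2 / t" using t0 by simp
      also have "\<dots> = t * (L X)\<^sup>2 + y\<^sup>2 / t - 2 * (\<bar>L X\<bar> * \<bar>y\<bar>)"
        using t0 by (simp add: power2_diff power_mult_distrib field_simps) (simp add: power2_eq_square)
      also have "\<bar>L X\<bar> * \<bar>y\<bar> = \<bar>L X * (h X - h1 X)\<bar>" by (simp add: abs_mult y_def)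
      finally have "\<bar>L X * (h X - h1 X)\<bar> \<le> (t * (L X)\<^sup>2 + (h X - h1 X)\<^sup>2 / t) / 2" by (simp add: y_def)
      moreover have "\<bar>W X * (L X * (h X - h1 X))\<bar> \<le> \<bar>L X * (h X - h1 X)\<bar>"
        using W X by (simp add: abs_mult mult_left_le_one_le)
      ultimately show "\<bar>W X * (L X * (h X - h1 X))\<bar> \<le> (t * (L X)\<^sup>2 + (h X - h1 X)\<^sup>2 / t) / 2" by linarith
    qed
    also have "\<dots> = (t * ?E (\<lambda>X. (L X)\<^sup>2) + ?E (\<lambda>X. (h X - h1 X)\<^sup>2) / t) / 2"
      by (simp add: int)
    also have "\<dots> \<le> (t * K + (t * (\<gamma> / 2)) / t) / 2"
      using L2 H2 t0 by (intro divide_right_mono add_mono mult_left_mono) auto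
    also have "\<dots> \<le> \<gamma> / 2" using tK t0 by simp
    finally have 2: "\<bar>?E (\<lambda>X. (W X * h X) * L X) - ?E (\<lambda>X. (W X * h1 X) * L X)\<bar> \<le> \<gamma> / 2" .
    have e1: "W X * (\<Prod>i\<in>insert a A. multilinear I (c i) (X i)) = (W X * h X) * (\<Prod>i\<in>A. multilinear I (c i) (X i))" for X
      using insert.hyps by (simp add: h_def)
    have e2: "W X * (\<Prod>i\<in>insert a A. multilinear I (truncate ((d(a := n)) i) (c i)) (X i)) = (W X * h1 X) * L X" for X
    proof -
      have "(\<Prod>i\<in>A. multilinear I (truncate ((d(a := n)) i) (c i)) (X i)) = L X"
        unfolding L_def using insert.hyps by (intro prod.cong) auto
      then show ?thesis using insert.hyps by (simp add: h1_def)
    qed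
    show "\<bar>?E (\<lambda>X. W X * (\<Prod>i\<in>insert a A. multilinear I (c i) (X i))) -
        ?E (\<lambda>X. W X * (\<Prod>i\<in>insert a A. multilinear I (truncate ((d(a := n)) i) (c i)) (X i)))\<bar> \<le> \<gamma>"
      unfolding e1 e2 using 1 2 by linarith
  qed
qed

section \<open>Choices of characters: pairings and triple overlaps\<close>

text \<open>Each coordinate lying in two characters becomes an edge between the two queries, so the
  degree of a vertex is the size of its character. The graph is chosen before \<mu>, which allows
  its weight to be averaged over a mixture.\<close>

lemma pairing_multigraph:
  fixes T :: "'k::finite \<Rightarrow> 'i set"
  assumes I: "finite I" and T: "\<And>i. i \<in> S \<Longrightarrow> T i \<subseteq> I"
    and pair: "\<And>j. j \<in> I \<Longrightarrow> card {i\<in>S. j \<in> T i} \<in> {0, 2}"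
    and odd: "\<And>i. i \<in> S \<Longrightarrow> odd (card (T i))"
  obtains G where "multigraph_on S G" "odd_degree S G" "size G \<le> (\<Sum>i\<in>S. card (T i))"
    "\<forall>\<mu> :: ('k \<Rightarrow> real) pmf. (\<Prod>j\<in>I. measure_pmf.expectation \<mu> (\<lambda>x. \<Prod>i\<in>{i\<in>S. j \<in> T i}. x i)) =
      (\<Prod>(a, b)\<in>#G. measure_pmf.expectation \<mu> (\<lambda>x. x a * x b))"
proof -
  define J where "J = {j\<in>I. card {i\<in>S. j \<in> T i} = 2}"
  have J: "finite J" unfolding J_def using I by simp
  have "\<forall>j\<in>J. \<exists>e. fst e \<noteq> snd e \<and> {i\<in>S. j \<in> T i} = {fst e, snd e}"
    unfolding J_def by (auto simp: card_2_iff)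
  then obtain e where e: "\<And>j. j \<in> J \<Longrightarrow> fst (e j) \<noteq> snd (e j)"
    "\<And>j. j \<in> J \<Longrightarrow> {i\<in>S. j \<in> T i} = {fst (e j), snd (e j)}"
    by metis
  define G where "G = image_mset e (mset_set J)"
  have eS: "fst (e j) \<in> S" "snd (e j) \<in> S" if "j \<in> J" for j using e(2)[OF that] by auto
  have "multigraph_on S G"
    unfolding multigraph_on_def G_def using e(1) eS J by (auto simp: case_prod_beta)
  moreover have "odd_degree S G"
    unfolding odd_degree_def
  proof
    fix v assume v: "v \<in> S"
    have "vertex_degree G v = card {j\<in>J. v = fst (e j) \<or> v = snd (e j)}"
      unfolding vertex_degree_def G_def using J by (simp add: filter_mset_image_mset)
    \<comment> \<open>A coordinate in \<open>T v\<close> is covered, hence covered twice by the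
      pairing hypothesis; so all of \<open>T v\<close> lies in \<open>J\<close>.\<close>
    also have "{j\<in>J. v = fst (e j) \<or> v = snd (e j)} = T v"
    proof (intro equalityI subsetI)
      fix j assume "j \<in> T v"
      then have jI: "j \<in> I" using T v by auto
      have "{i\<in>S. j \<in> T i} \<noteq> {}" using \<open>j \<in> T v\<close> v by auto
      then have "card {i\<in>S. j \<in> T i} \<noteq> 0" by simp
      then have "j \<in> J" using pair[OF jI] jI by (auto simp: J_def)
      then show "j \<in> {j\<in>J. v = fst (e j) \<or> v = snd (e j)}" using e(2)[of j] v \<open>j \<in> T v\<close> by auto
    qed (use e(2) in auto)
    finally show "odd (vertex_degree G v)" using odd[OF v] by simp
  qed
  moreover have "size G \<le> (\<Sum>i\<in>S. card (T i))"
  proof -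
    have "J \<subseteq> (\<Union>i\<in>S. T i)" using e(2) by auto
    then have "card J \<le> card (\<Union>i\<in>S. T i)"
      using T I by (intro card_mono finite_UN_I) (auto intro: finite_subset)
    also have "\<dots> \<le> (\<Sum>i\<in>S. card (T i))" by (intro card_UN_le) simp
    finally show ?thesis by (simp add: G_def)
  qed
  moreover have "(\<Prod>j\<in>I. measure_pmf.expectation \<mu> (\<lambda>x. \<Prod>i\<in>{i\<in>S. j \<in> T i}. x i)) =
      (\<Prod>(a, b)\<in>#G. measure_pmf.expectation \<mu> (\<lambda>x. x a * x b))" for \<mu> :: "('k \<Rightarrow> real) pmf"
  proof -
    have "(\<Prod>j\<in>I. measure_pmf.expectation \<mu> (\<lambda>x. \<Prod>i\<in>{i\<in>S. j \<in> T i}. x i)) =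
      (\<Prod>j\<in>J. measure_pmf.expectation \<mu> (\<lambda>x. \<Prod>i\<in>{i\<in>S. j \<in> T i}. x i))"
    proof (intro prod.mono_neutral_right I ballI)
      fix j assume "j \<in> I - J"
      then have "card {i\<in>S. j \<in> T i} = 0" using pair by (auto simp: J_def)
      then have *: "{i\<in>S. j \<in> T i} = {}" using card_0_eq[of "{i\<in>S. j \<in> T i}"] by simp
      show "measure_pmf.expectation \<mu> (\<lambda>x. \<Prod>i\<in>{i\<in>S. j \<in> T i}. x i) = 1" unfolding * by simp
    qed (auto simp: J_def)
    also have "\<dots> = (\<Prod>j\<in>J. measure_pmf.expectation \<mu> (\<lambda>x. x (fst (e j)) * x (snd (e j))))"
      using e by (intro prod.cong refl) simp
    also have "\<dots> = (\<Prod>(a, b)\<in>#G. measure_pmf.expectation \<mu> (\<lambda>x. x a * x b))"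
      unfolding G_def by (simp add: image_mset.compositionality comp_def case_prod_beta prod_unfold_prod_mset)
    finally show ?thesis .
  qed
  ultimately show ?thesis using that by blast
qed

text \<open>Requiring \<open>j\<close> in the three characters of \<open>B\<close> replaces three L2
  norms by square roots of influences of \<open>j\<close>. One of them yields
  \<open>sqrt \<tau>\<close>; the product of the other two is at most the sum of the influences,
  whose sum over \<open>j\<close> is bounded by degrees.\<close>

lemma triple_overlap_bound:
  fixes c :: "'k::finite \<Rightarrow> 'i set \<Rightarrow> real"
  assumes I: "finite I" and B: "B \<subseteq> S" "card B = 3"
    and d: "\<And>i T. i \<in> S \<Longrightarrow> T \<subseteq> I \<Longrightarrow> c i T \<noteq> 0 \<Longrightarrow> card T \<le> d i"
    and c: "\<And>i. (\<Sum>T\<in>Pow I. (c i T)\<^sup>2) \<le> 1"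
    and \<tau>0: "\<tau> \<ge> 0" and \<tau>: "\<And>i j. j \<in> I \<Longrightarrow> (\<Sum>T\<in>{T\<in>Pow I. j \<in> T}. (c i T)\<^sup>2) \<le> \<tau>"
  shows "(\<Sum>j\<in>I. \<Sum>T\<in>(\<Pi>\<^sub>E i\<in>S. Pow I). (\<Prod>j\<in>I. of_bool (card {i\<in>S. j \<in> T i} \<noteq> 1)) *
      (of_bool (\<forall>i\<in>B. j \<in> T i) * (\<Prod>i\<in>S. \<bar>c i (T i)\<bar>))) \<le>
    (\<Prod>i\<in>S. (2 ^ Suc (card S)) ^ d i) * (sqrt \<tau> * (\<Sum>i\<in>S. d i))"
proof -
  define C :: real where "C = (\<Prod>i\<in>S. (2 ^ Suc (card S)) ^ d i)"
  have C0: "C \<ge> 0" unfolding C_def by (intro prod_nonneg) auto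
  define inf where "inf i j = (\<Sum>T\<in>{T\<in>Pow I. j \<in> T}. (c i T)\<^sup>2)" for i j
  have inf0: "inf i j \<ge> 0" for i j unfolding inf_def by (intro sum_nonneg) auto
  have inf\<tau>: "inf i j \<le> \<tau>" if "j \<in> I" for i j using \<tau>[OF that] by (simp add: inf_def)
  \<comment> \<open>Total influence is at most the degree: a character \<open>T\<close> is counted
    once for each of its elements.\<close>
  have total: "(\<Sum>j\<in>I. inf i j) \<le> d i" if i: "i \<in> S" for i
  proof -
    have "(\<Sum>j\<in>I. inf i j) = (\<Sum>T\<in>Pow I. \<Sum>j\<in>{j\<in>I. j \<in> T}. (c i T)\<^sup>2)"
      unfolding inf_def using I by (intro sum.swap_restrict) auto
    also have "\<dots> \<le> (\<Sum>T\<in>Pow I. d i * (c i T)\<^sup>2)"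
    proof (intro sum_mono)
      fix T assume "T \<in> Pow I"
      then have "{j\<in>I. j \<in> T} = T" and "T \<subseteq> I" by auto
      then show "(\<Sum>j\<in>{j\<in>I. j \<in> T}. (c i T)\<^sup>2) \<le> d i * (c i T)\<^sup>2"
        using d[OF i, of T] by (cases "c i T = 0") (auto intro: mult_right_mono)
    qed
    also have "\<dots> \<le> real (d i) * 1"
      unfolding sum_distrib_left[symmetric] using c by (intro mult_left_mono) auto
    finally show ?thesis by simp
  qed
  have "(\<Sum>T\<in>(\<Pi>\<^sub>E i\<in>S. Pow I). (\<Prod>j\<in>I. of_bool (card {i\<in>S. j \<in> T i} \<noteq> 1)) *
      (of_bool (\<forall>i\<in>B. j \<in> T i) * (\<Prod>i\<in>S. \<bar>c i (T i)\<bar>))) \<le> C * (sqrt \<tau> * (\<Sum>i\<in>S. inf i j))"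
    if j: "j \<in> I" for j
  proof -
    \<comment> \<open>Deleting the characters that miss \<open>j\<close> moves the indicator into
      the coefficients, so that the covering bound applies and sees influences in place of full
      norms.\<close>
    define c' where "c' i T = (if i \<in> B \<and> j \<notin> T then 0 else c i T)" for i T
    have "of_bool (\<forall>i\<in>B. j \<in> T i) * (\<Prod>i\<in>S. \<bar>c i (T i)\<bar>) = (\<Prod>i\<in>S. \<bar>c' i (T i)\<bar>)" for T
    proof (cases "\<forall>i\<in>B. j \<in> T i")
      case True
      then show ?thesis by (auto simp: c'_def intro!: prod.cong)
    next
      case False
      then obtain i where "i \<in> S" "c' i (T i) = 0" using B by (auto simp: c'_def)
      then have "(\<Prod>i\<in>S. \<bar>c' i (T i)\<bar>) = 0" by (intro prod_zero) auto
      moreover have "of_bool (\<forall>i\<in>B. j \<in> T i) = (0 :: real)" using False by simp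
      ultimately show ?thesis by (simp only: mult_zero_left)
    qed
    then have "(\<Sum>T\<in>(\<Pi>\<^sub>E i\<in>S. Pow I). (\<Prod>j\<in>I. of_bool (card {i\<in>S. j \<in> T i} \<noteq> 1)) *
        (of_bool (\<forall>i\<in>B. j \<in> T i) * (\<Prod>i\<in>S. \<bar>c i (T i)\<bar>))) =
      (\<Sum>T\<in>(\<Pi>\<^sub>E i\<in>S. Pow I). (\<Prod>j\<in>I. of_bool (card {i\<in>S. j \<in> T i} \<noteq> 1)) * (\<Prod>i\<in>S. \<bar>c' i (T i)\<bar>))"
      by simp
    also have "\<dots> \<le> (\<Prod>i\<in>S. (2 ^ Suc (card S)) ^ d i * sqrt (\<Sum>T\<in>Pow I. (c' i T)\<^sup>2))"
      using d by (intro low_degree_covering_bound I) (auto simp: c'_def split: if_splits)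
    also have "\<dots> = C * (\<Prod>i\<in>S. sqrt (\<Sum>T\<in>Pow I. (c' i T)\<^sup>2))"
      unfolding C_def by (simp add: prod.distrib)
    also have "\<dots> \<le> C * (\<Prod>i\<in>S. if i \<in> B then sqrt (inf i j) else 1)"
    proof (intro mult_left_mono C0 prod_mono conjI)
      fix i assume "i \<in> S"
      have "(\<Sum>T\<in>Pow I. (c' i T)\<^sup>2) = inf i j" if "i \<in> B"
        unfolding inf_def using that I by (intro sum.mono_neutral_cong_right) (auto simp: c'_def)
      moreover have "(\<Sum>T\<in>Pow I. (c' i T)\<^sup>2) \<le> 1" if "i \<notin> B"
        using that c[of i] by (simp add: c'_def)
      ultimately show "sqrt (\<Sum>T\<in>Pow I. (c' i T)\<^sup>2) \<le> (if i \<in> B then sqrt (inf i j) else 1)"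
        by auto
    qed (auto intro: sum_nonneg)
    also have "\<dots> = C * (\<Prod>i\<in>B. sqrt (inf i j))"
      using B by (intro arg_cong[where f="(*) C"]) (simp add: prod.If_cases Int_absorb1)
    also have "\<dots> \<le> C * (sqrt \<tau> * (\<Sum>i\<in>S. inf i j))"
    proof (intro mult_left_mono C0)
      obtain x y z where xyz: "B = {x, y, z}" "x \<noteq> y" "x \<noteq> z" "y \<noteq> z"
        using B(2) by (auto simp: card_3_iff)
      have "sqrt (inf y j) * sqrt (inf z j) \<le> inf y j + inf z j"
        using sum_squares_bound[of "sqrt (inf y j)" "sqrt (inf z j)"] inf0[of y j] inf0[of z j]
          mult_nonneg_nonneg[OF real_sqrt_ge_zero[OF inf0[of y j]] real_sqrt_ge_zero[OF inf0[of z j]]]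
        by (simp del: mult_nonneg_nonneg)
      also have "\<dots> \<le> inf x j + (inf y j + inf z j)" using inf0[of x j] by simp
      finally have "sqrt (inf x j) * (sqrt (inf y j) * sqrt (inf z j)) \<le> sqrt \<tau> * (inf x j + (inf y j + inf z j))"
        using inf\<tau>[OF j, of x] inf0 \<tau>0 by (intro mult_mono) auto
      then have "(\<Prod>i\<in>B. sqrt (inf i j)) \<le> sqrt \<tau> * (\<Sum>i\<in>B. inf i j)" using xyz by simp
      also have "\<dots> \<le> sqrt \<tau> * (\<Sum>i\<in>S. inf i j)"
        using B inf0 \<tau>0 by (intro mult_left_mono sum_mono2) auto
      finally show "(\<Prod>i\<in>B. sqrt (inf i j)) \<le> sqrt \<tau> * (\<Sum>i\<in>S. inf i j)" .
    qed
    finally show ?thesis .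
  qed
  then have "(\<Sum>j\<in>I. \<Sum>T\<in>(\<Pi>\<^sub>E i\<in>S. Pow I). (\<Prod>j\<in>I. of_bool (card {i\<in>S. j \<in> T i} \<noteq> 1)) *
      (of_bool (\<forall>i\<in>B. j \<in> T i) * (\<Prod>i\<in>S. \<bar>c i (T i)\<bar>))) \<le> (\<Sum>j\<in>I. C * (sqrt \<tau> * (\<Sum>i\<in>S. inf i j)))"
    by (intro sum_mono)
  also have "\<dots> = C * (sqrt \<tau> * (\<Sum>i\<in>S. \<Sum>j\<in>I. inf i j))"
    using sum.swap[of inf I S] by (simp add: sum_distrib_left)
  also have "\<dots> \<le> C * (sqrt \<tau> * (\<Sum>i\<in>S. d i))"
    using C0 total \<tau>0 by (intro mult_left_mono) (auto simp: of_nat_sum intro!: sum_mono)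
  finally show ?thesis unfolding C_def .
qed

text \<open>Families made of pairs contribute at most \<gamma> each after averaging over
  \<open>M\<close>; the others are charged to a triple of queries and a coordinate common to their
  characters. The covering bound sums the coefficient weights, so an error \<gamma> per family costs
  \<gamma> times a constant, not times the number of families. Hence approximate vanishing
  suffices.\<close>

lemma expectation_mixture_low_degree_le:
  fixes c :: "'k::finite \<Rightarrow> 'i set \<Rightarrow> real" and M :: "('k \<Rightarrow> real) pmf pmf"
  assumes I: "finite I" and M: "finite (set_pmf M)" "\<And>\<mu>. \<mu> \<in> set_pmf M \<Longrightarrow> centered \<mu>"
    and d: "\<And>i T. i \<in> S \<Longrightarrow> T \<subseteq> I \<Longrightarrow> c i T \<noteq> 0 \<Longrightarrow> card T \<le> d i"
    and odd: "\<And>i T. i \<in> S \<Longrightarrow> T \<subseteq> I \<Longrightarrow> c i T \<noteq> 0 \<Longrightarrow> odd (card T)"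
    and c: "\<And>i. (\<Sum>T\<in>Pow I. (c i T)\<^sup>2) \<le> 1"
    and \<tau>0: "\<tau> \<ge> 0" and \<tau>: "\<And>i j. j \<in> I \<Longrightarrow> (\<Sum>T\<in>{T\<in>Pow I. j \<in> T}. (c i T)\<^sup>2) \<le> \<tau>"
    and \<gamma>: "\<And>G. multigraph_on S G \<Longrightarrow> odd_degree S G \<Longrightarrow> size G \<le> (\<Sum>i\<in>S. d i) \<Longrightarrow>
      \<bar>measure_pmf.expectation M (\<lambda>\<mu>. \<Prod>(a, b)\<in>#G. measure_pmf.expectation \<mu> (\<lambda>x. x a * x b))\<bar> \<le> \<gamma>"
    and \<gamma>0: "\<gamma> \<ge> 0"
  shows "\<bar>measure_pmf.expectation M (\<lambda>\<mu>. measure_pmf.expectation (iid_rows I \<mu>)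
      (\<lambda>X. \<Prod>i\<in>S. multilinear I (c i) (X i)))\<bar> \<le>
    (\<Prod>i\<in>S. (2 ^ Suc (card S)) ^ d i) * (\<gamma> + 2 ^ card S * (sqrt \<tau> * (\<Sum>i\<in>S. d i)))"
proof -
  define C :: real where "C = (\<Prod>i\<in>S. (2 ^ Suc (card S)) ^ d i)"
  have C0: "C \<ge> 0" unfolding C_def by (intro prod_nonneg) auto
  define \<P> where "\<P> = (\<Pi>\<^sub>E i\<in>S. Pow I)"
  define N where "N T \<mu> = (\<Prod>j\<in>I. measure_pmf.expectation \<mu> (\<lambda>x. \<Prod>i\<in>{i\<in>S. j \<in> T i}. x i))"
    for T and \<mu> :: "('k \<Rightarrow> real) pmf"
  define adm where "adm T = (\<Prod>j\<in>I. of_bool (card {i\<in>S. j \<in> T i} \<noteq> 1) :: real)" for T :: "'k \<Rightarrow> 'i set"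
  define \<B> where "\<B> = {B. B \<subseteq> S \<and> card B = 3}"
  have adm0: "adm T \<ge> 0" for T unfolding adm_def by (intro prod_nonneg) auto
  have int: "integrable (measure_pmf M) h" for h :: "_ \<Rightarrow> real"
    by (intro integrable_measure_pmf_finite M)
  have "measure_pmf.expectation M (\<lambda>\<mu>. measure_pmf.expectation (iid_rows I \<mu>) (\<lambda>X. \<Prod>i\<in>S. multilinear I (c i) (X i))) =
    measure_pmf.expectation M (\<lambda>\<mu>. \<Sum>T\<in>\<P>. (\<Prod>i\<in>S. c i (T i)) * N T \<mu>)"
    unfolding \<P>_def N_def using M(2)
    by (intro integral_cong_AE) (auto simp: AE_measure_pmf_iff centered_def expectation_iid_rows_multilinear[OF I, where \<phi>="\<lambda>i. i"])
  also have "\<dots> = (\<Sum>T\<in>\<P>. (\<Prod>i\<in>S. c i (T i)) * measure_pmf.expectation M (N T))"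
    by (simp add: Bochner_Integration.integral_sum int)
  finally have "\<bar>measure_pmf.expectation M (\<lambda>\<mu>. measure_pmf.expectation (iid_rows I \<mu>)
      (\<lambda>X. \<Prod>i\<in>S. multilinear I (c i) (X i)))\<bar> \<le> (\<Sum>T\<in>\<P>. \<bar>(\<Prod>i\<in>S. c i (T i)) * measure_pmf.expectation M (N T)\<bar>)"
    by simp
  \<comment> \<open>The double sum counts the triples \<open>B\<close> and coordinates
    \<open>j\<close> with \<open>j\<close> in all characters of \<open>B\<close>. It is at least 1
    as soon as three characters share a coordinate, and it splits into the sums treated by
    \<open>triple_overlap_bound\<close>.\<close>
  also have "\<dots> \<le> (\<Sum>T\<in>\<P>. (\<Prod>i\<in>S. \<bar>c i (T i)\<bar>) * (adm T * (\<gamma> + (\<Sum>B\<in>\<B>. \<Sum>j\<in>I. of_bool (\<forall>i\<in>B. j \<in> T i)))))"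
    unfolding abs_mult abs_prod
  proof (intro sum_mono)
    fix T assume T: "T \<in> \<P>"
    then have TI: "T i \<subseteq> I" if "i \<in> S" for i using that by (auto simp: \<P>_def PiE_iff)
    have cnt0: "(\<Sum>B\<in>\<B>. \<Sum>j\<in>I. of_bool (\<forall>i\<in>B. j \<in> T i)) \<ge> (0::real)"
      by (intro sum_nonneg) auto
    have N_le: "\<bar>N T \<mu>\<bar> \<le> adm T" if "\<mu> \<in> set_pmf M" for \<mu>
      unfolding N_def adm_def abs_prod using M(2)[OF that]
      by (intro prod_mono conjI abs_moment_le_covering) auto
    have EN_le: "\<bar>measure_pmf.expectation M (N T)\<bar> \<le> adm T"
      by (rule abs_expectation_pmf_le) (rule N_le)
    have adm01: "adm T = 0 \<or> adm T = 1"
      unfolding adm_def using I by (induction I rule: finite_induct) auto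
    show "(\<Prod>i\<in>S. \<bar>c i (T i)\<bar>) * \<bar>measure_pmf.expectation M (N T)\<bar> \<le>
      (\<Prod>i\<in>S. \<bar>c i (T i)\<bar>) * (adm T * (\<gamma> + (\<Sum>B\<in>\<B>. \<Sum>j\<in>I. of_bool (\<forall>i\<in>B. j \<in> T i))))"
    proof (cases "adm T = 0 \<or> (\<exists>i\<in>S. c i (T i) = 0)")
      case True
      then show ?thesis
      proof
        assume "\<exists>i\<in>S. c i (T i) = 0"
        then have "(\<Prod>i\<in>S. \<bar>c i (T i)\<bar>) = 0" by (intro prod_zero) auto
        then show ?thesis by (simp only: mult_zero_left)
      qed (use EN_le in simp)
    next
      case False
      then have adm1: "adm T = 1" and nz: "\<And>i. i \<in> S \<Longrightarrow> c i (T i) \<noteq> 0" using adm01 by auto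
      have n1: "card {i\<in>S. j \<in> T i} \<noteq> 1" if "j \<in> I" for j
        using False that I by (auto simp: adm_def)
      have "\<bar>measure_pmf.expectation M (N T)\<bar> \<le> \<gamma> + (\<Sum>B\<in>\<B>. \<Sum>j\<in>I. of_bool (\<forall>i\<in>B. j \<in> T i))"
      proof (cases "\<exists>j\<in>I. card {i\<in>S. j \<in> T i} \<ge> 3")
        case True
        then obtain j where j: "j \<in> I" "card {i\<in>S. j \<in> T i} \<ge> 3" by auto
        then obtain B where B: "B \<subseteq> {i\<in>S. j \<in> T i}" "card B = 3"
          by (meson obtain_subset_with_card_n)
        have "(1::real) = of_bool (\<forall>i\<in>B. j \<in> T i)" using B by auto
        also have "\<dots> \<le> (\<Sum>j\<in>I. of_bool (\<forall>i\<in>B. j \<in> T i))"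
          using j I by (intro member_le_sum[where f="\<lambda>j. of_bool (\<forall>i\<in>B. j \<in> T i)"]) auto
        also have "\<dots> \<le> (\<Sum>B\<in>\<B>. \<Sum>j\<in>I. of_bool (\<forall>i\<in>B. j \<in> T i))"
          using B by (intro member_le_sum[where f="\<lambda>B. \<Sum>j\<in>I. of_bool (\<forall>i\<in>B. j \<in> T i)"])
            (auto simp: \<B>_def intro: sum_nonneg)
        finally show ?thesis using EN_le adm1 \<gamma>0 by linarith
      next
        case False
        have pair: "card {i\<in>S. j \<in> T i} \<in> {0, 2}" if "j \<in> I" for j
        proof -
          have "card {i\<in>S. j \<in> T i} < 3" using False that by auto
          then have "card {i\<in>S. j \<in> T i} = 0 \<or> card {i\<in>S. j \<in> T i} = 2" using n1[OF that] by linarith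
          then show ?thesis by blast
        qed
        have oddT: "odd (card (T i))" if "i \<in> S" for i using odd[OF that TI[OF that] nz[OF that]] .
        obtain G where G: "multigraph_on S G" "odd_degree S G" "size G \<le> (\<Sum>i\<in>S. card (T i))"
          "\<forall>\<mu> :: ('k \<Rightarrow> real) pmf. (\<Prod>j\<in>I. measure_pmf.expectation \<mu> (\<lambda>x. \<Prod>i\<in>{i\<in>S. j \<in> T i}. x i)) =
            (\<Prod>(a, b)\<in>#G. measure_pmf.expectation \<mu> (\<lambda>x. x a * x b))"
          using pairing_multigraph[OF I TI pair oddT] by blast
        have "(\<Sum>i\<in>S. card (T i)) \<le> (\<Sum>i\<in>S. d i)"
          using d TI nz by (intro sum_mono) auto
        then have "\<bar>measure_pmf.expectation M (N T)\<bar> \<le> \<gamma>"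
          unfolding N_def G(4)[rule_format] using G(3) by (intro \<gamma> G(1,2)) auto
        then show ?thesis using cnt0 by linarith
      qed
      then show ?thesis unfolding adm1 by (intro mult_left_mono prod_nonneg) auto
    qed
  qed
  also have "\<dots> = \<gamma> * (\<Sum>T\<in>\<P>. adm T * (\<Prod>i\<in>S. \<bar>c i (T i)\<bar>)) +
    (\<Sum>T\<in>\<P>. \<Sum>B\<in>\<B>. \<Sum>j\<in>I. adm T * (of_bool (\<forall>i\<in>B. j \<in> T i) * (\<Prod>i\<in>S. \<bar>c i (T i)\<bar>)))"
    unfolding sum_distrib_left[of \<gamma>] sum.distrib[symmetric]
  proof (intro sum.cong refl)
    fix T :: "'k \<Rightarrow> 'i set"
    define f where "f B j = (of_bool (\<forall>i\<in>B. j \<in> T i) :: real)" for B j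
    define p where "p = (\<Prod>i\<in>S. \<bar>c i (T i)\<bar>)"
    have "(\<Sum>B\<in>\<B>. \<Sum>j\<in>I. adm T * (f B j * p)) = p * (adm T * (\<Sum>B\<in>\<B>. \<Sum>j\<in>I. f B j))"
      unfolding sum_distrib_left by (intro sum.cong refl) (simp only: mult_ac)
    moreover have "p * (adm T * (\<gamma> + (\<Sum>B\<in>\<B>. \<Sum>j\<in>I. f B j))) =
        \<gamma> * (adm T * p) + p * (adm T * (\<Sum>B\<in>\<B>. \<Sum>j\<in>I. f B j))"
      by (simp only: distrib_left mult_ac)
    ultimately have "p * (adm T * (\<gamma> + (\<Sum>B\<in>\<B>. \<Sum>j\<in>I. f B j))) =
        \<gamma> * (adm T * p) + (\<Sum>B\<in>\<B>. \<Sum>j\<in>I. adm T * (f B j * p))" by simp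
    then show "(\<Prod>i\<in>S. \<bar>c i (T i)\<bar>) * (adm T * (\<gamma> + (\<Sum>B\<in>\<B>. \<Sum>j\<in>I. of_bool (\<forall>i\<in>B. j \<in> T i)))) =
        \<gamma> * (adm T * (\<Prod>i\<in>S. \<bar>c i (T i)\<bar>)) +
        (\<Sum>B\<in>\<B>. \<Sum>j\<in>I. adm T * (of_bool (\<forall>i\<in>B. j \<in> T i) * (\<Prod>i\<in>S. \<bar>c i (T i)\<bar>)))"
      unfolding f_def p_def .
  qed
  also have "(\<Sum>T\<in>\<P>. \<Sum>B\<in>\<B>. \<Sum>j\<in>I. adm T * (of_bool (\<forall>i\<in>B. j \<in> T i) * (\<Prod>i\<in>S. \<bar>c i (T i)\<bar>))) =
    (\<Sum>B\<in>\<B>. \<Sum>j\<in>I. \<Sum>T\<in>\<P>. adm T * (of_bool (\<forall>i\<in>B. j \<in> T i) * (\<Prod>i\<in>S. \<bar>c i (T i)\<bar>)))"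
    by (subst sum.swap, intro sum.cong refl, rule sum.swap)
  also have "\<gamma> * (\<Sum>T\<in>\<P>. adm T * (\<Prod>i\<in>S. \<bar>c i (T i)\<bar>)) + \<dots> \<le> \<gamma> * C + (\<Sum>B\<in>\<B>. C * (sqrt \<tau> * (\<Sum>i\<in>S. d i)))"
  proof (intro add_mono mult_left_mono \<gamma>0 sum_mono)
    have "(\<Sum>T\<in>\<P>. adm T * (\<Prod>i\<in>S. \<bar>c i (T i)\<bar>)) \<le> (\<Prod>i\<in>S. (2 ^ Suc (card S)) ^ d i * sqrt (\<Sum>T\<in>Pow I. (c i T)\<^sup>2))"
      unfolding \<P>_def adm_def by (intro low_degree_covering_bound I d) auto
    also have "\<dots> \<le> (\<Prod>i\<in>S. (2 ^ Suc (card S)) ^ d i * 1)"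
      using c by (intro prod_mono conjI mult_left_mono mult_nonneg_nonneg) (auto intro: sum_nonneg)
    finally show "(\<Sum>T\<in>\<P>. adm T * (\<Prod>i\<in>S. \<bar>c i (T i)\<bar>)) \<le> C" by (simp add: C_def)
  next
    fix B assume "B \<in> \<B>"
    then show "(\<Sum>j\<in>I. \<Sum>T\<in>\<P>. adm T * (of_bool (\<forall>i\<in>B. j \<in> T i) * (\<Prod>i\<in>S. \<bar>c i (T i)\<bar>))) \<le> C * (sqrt \<tau> * (\<Sum>i\<in>S. d i))"
      unfolding C_def \<P>_def adm_def by (intro triple_overlap_bound I d c \<tau>0 \<tau>) (auto simp: \<B>_def)
  qed
  also have "(\<Sum>B\<in>\<B>. C * (sqrt \<tau> * (\<Sum>i\<in>S. d i))) \<le> 2 ^ card S * (C * (sqrt \<tau> * (\<Sum>i\<in>S. d i)))"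
  proof -
    have "card \<B> \<le> card (Pow S)" by (intro card_mono) (auto simp: \<B>_def)
    then have "real (card \<B>) \<le> real (2 ^ card S)" by (simp only: card_Pow[OF finite] of_nat_le_iff)
    then have "real (card \<B>) \<le> 2 ^ card S" by simp
    then have "real (card \<B>) * (C * (sqrt \<tau> * (\<Sum>i\<in>S. d i))) \<le> 2 ^ card S * (C * (sqrt \<tau> * (\<Sum>i\<in>S. d i)))"
      using C0 \<tau>0 by (auto intro!: mult_right_mono mult_nonneg_nonneg sum_nonneg)
    then show ?thesis by simp
  qed
  finally show ?thesis unfolding C_def by (simp add: algebra_simps)
qed

section \<open>Noise and finitely supported mixtures\<close>

lemma expectation_pair_pmf_mult:
  fixes F :: "'a \<Rightarrow> real" and G :: "'b \<Rightarrow> real"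
  assumes p: "finite (set_pmf p)" and q: "finite (set_pmf q)"
  shows "measure_pmf.expectation (pair_pmf p q) (\<lambda>z. F (fst z) * G (snd z)) =
    measure_pmf.expectation p F * measure_pmf.expectation q G"
proof -
  have "measure_pmf.expectation (pair_pmf p q) (\<lambda>z. F (fst z) * G (snd z)) =
    (\<Sum>z\<in>set_pmf p \<times> set_pmf q. pmf (pair_pmf p q) z *\<^sub>R (F (fst z) * G (snd z)))"
    using p q by (intro integral_measure_pmf) auto
  also have "\<dots> = (\<Sum>a\<in>set_pmf p. \<Sum>b\<in>set_pmf q. (pmf p a * F a) * (pmf q b * G b))"
    unfolding sum.cartesian_product by (auto intro!: sum.cong simp: pmf_pair mult_ac)
  also have "\<dots> = (\<Sum>a\<in>set_pmf p. pmf p a *\<^sub>R F a) * (\<Sum>b\<in>set_pmf q. pmf q b *\<^sub>R G b)"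
    by (simp add: sum_product)
  also have "\<dots> = measure_pmf.expectation p F * measure_pmf.expectation q G"
    using p q by (intro arg_cong2[of _ _ _ _ "(*)"] integral_measure_pmf[symmetric]) auto
  finally show ?thesis .
qed

definition sign_pmf :: "real \<Rightarrow> real pmf" where
  "sign_pmf r = map_pmf (\<lambda>b. if b then 1 else -1) (bernoulli_pmf ((1 + r) / 2))"

text \<open>Every bit is multiplied by a sign of mean \<open>r\<close>, independently across
  queries. A moment over \<open>A\<close> thus gains the factor \<open>r ^ card A\<close>, as if the
  noise operator were applied to each function separately.\<close>

definition noisy :: "real \<Rightarrow> ('k::finite \<Rightarrow> real) pmf \<Rightarrow> ('k \<Rightarrow> real) pmf" where
  "noisy r \<mu> = map_pmf (\<lambda>z i. fst z i * snd z i) (pair_pmf \<mu> (Pi_pmf UNIV 0 (\<lambda>_. sign_pmf r)))"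

lemma set_sign_pmf: "set_pmf (sign_pmf r) \<subseteq> {-1, 1}"
  by (auto simp: sign_pmf_def)

lemma finite_set_sign_pmf: "finite (set_pmf (sign_pmf r))"
  by (rule finite_subset[OF set_sign_pmf]) simp

lemma set_Pi_sign_pmf: "set_pmf (Pi_pmf UNIV 0 (\<lambda>_. sign_pmf r)) \<subseteq> cube (UNIV :: 'k::finite set)"
  using set_sign_pmf[of r] by (fastforce simp: set_Pi_pmf PiE_dflt_def cube_def)

lemma set_noisy:
  assumes "set_pmf \<mu> \<subseteq> cube UNIV"
  shows "set_pmf (noisy r \<mu>) \<subseteq> cube UNIV"
proof
  fix x assume "x \<in> set_pmf (noisy r \<mu>)"
  then obtain y z where x: "x = (\<lambda>i. y i * z i)" and "y \<in> set_pmf \<mu>"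
    "z \<in> set_pmf (Pi_pmf UNIV 0 (\<lambda>_. sign_pmf r))"
    by (auto simp: noisy_def)
  then have yz: "y \<in> cube UNIV" "z \<in> cube UNIV" using assms set_Pi_sign_pmf[of r] by auto
  have "y i * z i \<in> {-1, 1}" for i
    using cube_range[OF yz(1), of i] cube_range[OF yz(2), of i] by auto
  then show "x \<in> cube UNIV" by (auto simp: x cube_def)
qed

lemma expectation_noisy_monomial:
  fixes \<mu> :: "('k::finite \<Rightarrow> real) pmf"
  assumes \<mu>: "set_pmf \<mu> \<subseteq> cube UNIV" and r: "0 \<le> r" "r \<le> 1"
  shows "measure_pmf.expectation (noisy r \<mu>) (\<lambda>x. \<Prod>i\<in>A. x i) =
    r ^ card A * measure_pmf.expectation \<mu> (\<lambda>x. \<Prod>i\<in>A. x i)"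
proof -
  let ?Z = "Pi_pmf (UNIV :: 'k set) 0 (\<lambda>_. sign_pmf r)"
  have mean: "measure_pmf.expectation (sign_pmf r) (\<lambda>z. z) = r"
    using r unfolding sign_pmf_def by (simp add: field_simps)
  have "measure_pmf.expectation ?Z (\<lambda>z. \<Prod>i\<in>A. z i) =
      measure_pmf.expectation ?Z (\<lambda>z. \<Prod>i\<in>UNIV. if i \<in> A then z i else 1)"
    by (simp add: prod.If_cases)
  also have "\<dots> = (\<Prod>i\<in>UNIV. measure_pmf.expectation (sign_pmf r) (\<lambda>z. if i \<in> A then z else 1))"
    using expectation_prod_Pi_pmf_finite[OF finite finite_set_sign_pmf, where g = "\<lambda>i z. if i \<in> A then z else 1"]
    by simp
  also have "\<dots> = (\<Prod>i\<in>UNIV. if i \<in> A then r else 1)"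
    by (intro prod.cong) (auto simp: mean)
  also have "\<dots> = r ^ card A" by (simp add: prod.If_cases)
  finally have Z: "measure_pmf.expectation ?Z (\<lambda>z. \<Prod>i\<in>A. z i) = r ^ card A" .
  have "finite (set_pmf ?Z)"
    by (rule finite_subset[OF set_Pi_sign_pmf finite_cube]) simp
  then show ?thesis
    using expectation_pair_pmf_mult[OF finite_set_cube_pmf[OF \<mu>], of ?Z "\<lambda>x. \<Prod>i\<in>A. x i" "\<lambda>z. \<Prod>i\<in>A. z i"]
    unfolding noisy_def by (simp add: Z prod.distrib)
qed

text \<open>On the cube the smoothed function is the multilinear extension of \<open>f\<close> at
  \<open>r * x\<close>, hence still bounded by 1. The tail decays because
  \<open>(r ^ card T)\<^sup>2 \<le> r ^ d\<close> for \<open>card T > d\<close>.\<close>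

lemma smooth_noise:
  fixes I :: "'i set"
  assumes I: "finite I" and f: "\<And>x. x \<in> cube I \<Longrightarrow> \<bar>f x\<bar> \<le> 1" and r: "0 \<le> r" "r \<le> 1"
  shows "smooth r I (\<lambda>T. r ^ card T * fourier_coeff I f T)"
  unfolding smooth_def
proof (intro conjI ballI allI)
  fix x assume x: "x \<in> cube I"
  have "multilinear I (\<lambda>T. r ^ card T * fourier_coeff I f T) x = multilinear_ext I f (\<lambda>i. r * x i)"
    by (simp add: multilinear_def multilinear_ext_def prod.distrib mult_ac)
  also have "\<bar>\<dots>\<bar> \<le> 1"
  proof (rule abs_multilinear_ext_le[OF I f])
    fix i assume "i \<in> I"
    then have "\<bar>x i\<bar> = 1" using cube_range[OF x] by fastforce
    then show "\<bar>r * x i\<bar> \<le> 1" using r by (simp add: abs_mult)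
  qed
  finally show "\<bar>multilinear I (\<lambda>T. r ^ card T * fourier_coeff I f T) x\<bar> \<le> 1" .
next
  have tail: "(\<Sum>T\<in>Pow I. (r ^ card T * fourier_coeff I f T - truncate d (\<lambda>T. r ^ card T * fourier_coeff I f T) T)\<^sup>2) \<le> r ^ d" for d
  proof -
    have "(\<Sum>T\<in>Pow I. (r ^ card T * fourier_coeff I f T - truncate d (\<lambda>T. r ^ card T * fourier_coeff I f T) T)\<^sup>2)
      \<le> (\<Sum>T\<in>Pow I. r ^ d * (fourier_coeff I f T)\<^sup>2)"
    proof (intro sum_mono)
      fix T :: "'i set"
      have "(r ^ card T)\<^sup>2 \<le> r ^ d" if "card T > d"
        unfolding power_mult[symmetric] using that r by (intro power_decreasing) auto
      then show "(r ^ card T * fourier_coeff I f T - truncate d (\<lambda>T. r ^ card T * fourier_coeff I f T) T)\<^sup>2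
          \<le> r ^ d * (fourier_coeff I f T)\<^sup>2"
        using r by (auto simp: truncate_def power_mult_distrib intro!: mult_right_mono)
    qed
    also have "\<dots> \<le> r ^ d * 1"
      unfolding sum_distrib_left[symmetric] using r
      by (intro mult_left_mono sum_fourier_coeff_square_le I f) auto
    finally show ?thesis by simp
  qed
  show "(\<Sum>T\<in>Pow I. (r ^ card T * fourier_coeff I f T - truncate d (\<lambda>T. r ^ card T * fourier_coeff I f T) T)\<^sup>2) \<le> r ^ d" for d
    by (rule tail)
  have "(\<Sum>T\<in>Pow I. (r ^ card T * fourier_coeff I f T)\<^sup>2) \<le> (\<Sum>T\<in>Pow I. (fourier_coeff I f T)\<^sup>2)"
    unfolding power_mult_distrib using r
    by (intro sum_mono mult_left_le_one_le) (auto intro!: power_le_one)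
  also have "\<dots> \<le> 1" by (rule sum_fourier_coeff_square_le[OF I f])
  finally show "(\<Sum>T\<in>Pow I. (r ^ card T * fourier_coeff I f T)\<^sup>2) \<le> 1" .
qed

text \<open>Double counting of incidences between coordinates and characters moves the noise from
  the queries to the functions: \<open>r\<close> to the number of members containing
  \<open>j\<close>, multiplied over \<open>j\<close>, equals \<open>r ^ card (T i)\<close>
  multiplied over \<open>i\<close>.\<close>

lemma expectation_iid_rows_noisy:
  fixes \<mu> :: "('k::finite \<Rightarrow> real) pmf"
  assumes I: "finite I" and \<mu>: "set_pmf \<mu> \<subseteq> cube UNIV" and r: "0 \<le> r" "r \<le> 1"
  shows "measure_pmf.expectation (iid_rows I (noisy r \<mu>)) (\<lambda>X. \<Prod>i\<in>S. f i (X i)) =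
    measure_pmf.expectation (iid_rows I \<mu>)
      (\<lambda>X. \<Prod>i\<in>S. multilinear I (\<lambda>T. r ^ card T * fourier_coeff I (f i) T) (X i))"
proof -
  have "measure_pmf.expectation (iid_rows I (noisy r \<mu>)) (\<lambda>X. \<Prod>i\<in>S. f i (X i)) =
    measure_pmf.expectation (iid_rows I (noisy r \<mu>)) (\<lambda>X. \<Prod>i\<in>S. multilinear I (fourier_coeff I (f i)) (X i))"
  proof (intro integral_cong_AE)
    show "AE X in iid_rows I (noisy r \<mu>). (\<Prod>i\<in>S. f i (X i)) = (\<Prod>i\<in>S. multilinear I (fourier_coeff I (f i)) (X i))"
      unfolding AE_measure_pmf_iff
      using iid_rows_in_cube[OF I set_noisy[OF \<mu>]] multilinear_ext_on_cube[OF I]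
      by (auto simp: multilinear_def multilinear_ext_def intro!: prod.cong)
  qed auto
  also have "\<dots> = (\<Sum>T\<in>(\<Pi>\<^sub>E i\<in>S. Pow I). (\<Prod>i\<in>S. fourier_coeff I (f i) (T i)) *
      (\<Prod>j\<in>I. r ^ card {i\<in>S. j \<in> T i} * measure_pmf.expectation \<mu> (\<lambda>x. \<Prod>i\<in>{i\<in>S. j \<in> T i}. x i)))"
    using expectation_iid_rows_multilinear[OF I set_noisy[OF \<mu>], where \<phi> = "\<lambda>i. i" and Q = S]
    by (simp add: expectation_noisy_monomial[OF \<mu> r])
  also have "\<dots> = (\<Sum>T\<in>(\<Pi>\<^sub>E i\<in>S. Pow I). (\<Prod>i\<in>S. r ^ card (T i) * fourier_coeff I (f i) (T i)) *
      (\<Prod>j\<in>I. measure_pmf.expectation \<mu> (\<lambda>x. \<Prod>i\<in>{i\<in>S. j \<in> T i}. x i)))"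
  proof (intro sum.cong refl)
    fix T assume T: "T \<in> (\<Pi>\<^sub>E i\<in>S. Pow I)"
    have "(\<Prod>i\<in>S. r ^ card (T i)) = (\<Prod>i\<in>S. \<Prod>j\<in>{j\<in>I. j \<in> T i}. r)"
      using T by (intro prod.cong) (auto simp: PiE_iff Int_absorb1 simp flip: Int_def)
    also have "\<dots> = (\<Prod>j\<in>I. \<Prod>i\<in>{i\<in>S. j \<in> T i}. r)"
      by (rule prod.swap_restrict[OF finite I])
    finally show "(\<Prod>i\<in>S. fourier_coeff I (f i) (T i)) *
        (\<Prod>j\<in>I. r ^ card {i\<in>S. j \<in> T i} * measure_pmf.expectation \<mu> (\<lambda>x. \<Prod>i\<in>{i\<in>S. j \<in> T i}. x i)) =
      (\<Prod>i\<in>S. r ^ card (T i) * fourier_coeff I (f i) (T i)) *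
        (\<Prod>j\<in>I. measure_pmf.expectation \<mu> (\<lambda>x. \<Prod>i\<in>{i\<in>S. j \<in> T i}. x i))"
      by (simp add: prod.distrib)
  qed
  also have "\<dots> = measure_pmf.expectation (iid_rows I \<mu>)
      (\<lambda>X. \<Prod>i\<in>S. multilinear I (\<lambda>T. r ^ card T * fourier_coeff I (f i) T) (X i))"
    using expectation_iid_rows_multilinear[OF I \<mu>, where \<phi> = "\<lambda>i. i" and Q = S] by simp
  finally show ?thesis .
qed

text \<open>One uniform sign is applied to the whole vector: this kills the means and keeps all pair
  moments, whereas independent signs would destroy the correlations. Evenness of \<open>P\<close>
  keeps the support accepted.\<close>

lemma symmetrize:
  fixes \<mu> :: "('k::finite \<Rightarrow> real) pmf"
  assumes P: "even_function UNIV P" and \<mu>: "supported_distribution P \<mu>"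
  obtains \<mu>' where "centered \<mu>'" "supported_distribution P \<mu>'"
    "\<forall>i j. measure_pmf.expectation \<mu>' (\<lambda>x. x i * x j) = measure_pmf.expectation \<mu> (\<lambda>x. x i * x j)"
proof -
  define \<mu>' where "\<mu>' = pmf_of_set {-1, 1 :: real} \<bind> (\<lambda>s. map_pmf (\<lambda>x i. s * x i) \<mu>)"
  have \<mu>c: "set_pmf \<mu> \<subseteq> cube UNIV" using \<mu> by (auto simp: supported_distribution_def)
  have E: "measure_pmf.expectation \<mu>' h =
      (measure_pmf.expectation \<mu> (\<lambda>x. h (\<lambda>i. - x i)) + measure_pmf.expectation \<mu> h) / 2"
    for h :: "_ \<Rightarrow> real"
    unfolding \<mu>'_def using finite_set_cube_pmf[OF \<mu>c]
    by (subst pmf_expectation_bind_pmf_of_set) (auto simp: field_simps)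
  have supp: "supported_distribution P \<mu>'"
    unfolding supported_distribution_def
  proof
    fix y assume "y \<in> set_pmf \<mu>'"
    then consider x where "x \<in> set_pmf \<mu>" "y = (\<lambda>i. - x i)" | "y \<in> set_pmf \<mu>"
      by (auto simp: \<mu>'_def)
    then show "y \<in> {x \<in> cube UNIV. P x = 1}"
    proof cases
      case 1
      then have x: "x \<in> cube UNIV" "P x = 1" using \<mu> by (auto simp: supported_distribution_def)
      have "antipode UNIV x = y" using 1 by (simp add: antipode_def restrict_def)
      moreover have "antipode UNIV x \<in> cube UNIV"
        using cube_range[OF x(1)] by (fastforce simp: antipode_def cube_def)
      moreover have "P (antipode UNIV x) = 1" using P x by (simp add: even_function_def)
      ultimately show ?thesis by simp
    qed (use \<mu> in \<open>auto simp: supported_distribution_def\<close>)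
  qed
  moreover from supp have "centered \<mu>'"
    unfolding centered_def by (auto simp: E supported_distribution_def)
  moreover have "\<forall>i j. measure_pmf.expectation \<mu>' (\<lambda>x. x i * x j) = measure_pmf.expectation \<mu> (\<lambda>x. x i * x j)"
    by (simp add: E)
  ultimately show ?thesis using that by blast
qed

section \<open>Discretization of distributions over correlation matrices\<close>

definition correlation :: "('k::finite \<Rightarrow> real) pmf \<Rightarrow> real^'k^'k" where
  "correlation \<mu> = (\<chi> i j. measure_pmf.expectation \<mu> (\<lambda>x. x i * x j))"

lemma edge_weight_correlation:
  "edge_weight (correlation \<mu>) G = (\<Prod>(i, j)\<in>#G. measure_pmf.expectation \<mu> (\<lambda>x. x i * x j))"
  by (simp add: edge_weight_def correlation_def)

lemma abs_correlation_le:
  assumes "supported_correlation P \<rho>"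
  shows "\<bar>\<rho> $ i $ j\<bar> \<le> 1"
proof -
  obtain \<mu> where \<mu>: "supported_distribution P \<mu>" "\<rho> $ i $ j = measure_pmf.expectation \<mu> (\<lambda>x. x i * x j)"
    using assms by (auto simp: supported_correlation_def)
  show ?thesis unfolding \<mu>(2)
  proof (rule abs_expectation_pmf_le)
    fix x assume "x \<in> set_pmf \<mu>"
    then have x: "x \<in> cube UNIV" using \<mu>(1) by (auto simp: supported_distribution_def)
    show "\<bar>x i * x j\<bar> \<le> 1" using cube_range[OF x, of i] cube_range[OF x, of j] by auto
  qed
qed

lemma abs_prod_mset_le_1:
  fixes x :: "'a \<Rightarrow> real"
  assumes "\<And>p. \<bar>x p\<bar> \<le> 1"
  shows "\<bar>\<Prod>p\<in>#G. x p\<bar> \<le> 1"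
  using assms by (induction G) (auto simp: abs_mult intro!: mult_le_one)

text \<open>Factors are exchanged one at a time; all remaining factors have absolute value at most
  1.\<close>

lemma abs_prod_mset_diff_le:
  fixes x y :: "'a \<Rightarrow> real" and e :: real
  assumes x: "\<And>p. \<bar>x p\<bar> \<le> 1" and y: "\<And>p. \<bar>y p\<bar> \<le> 1" and e: "\<And>p. \<bar>x p - y p\<bar> \<le> e"
  shows "\<bar>(\<Prod>p\<in>#G. x p) - (\<Prod>p\<in>#G. y p)\<bar> \<le> size G * e"
proof (induction G)
  case (add p G)
  have "\<bar>(\<Prod>p\<in>#add_mset p G. x p) - (\<Prod>p\<in>#add_mset p G. y p)\<bar> =
    \<bar>(x p - y p) * (\<Prod>p\<in>#G. x p) + y p * ((\<Prod>p\<in>#G. x p) - (\<Prod>p\<in>#G. y p))\<bar>"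
    by (simp add: algebra_simps)
  also have "\<dots> \<le> \<bar>x p - y p\<bar> * \<bar>\<Prod>p\<in>#G. x p\<bar> + \<bar>y p\<bar> * \<bar>(\<Prod>p\<in>#G. x p) - (\<Prod>p\<in>#G. y p)\<bar>"
    unfolding abs_mult[symmetric] by (rule abs_triangle_ineq)
  also have "\<dots> \<le> e * 1 + 1 * (size G * e)"
    using abs_prod_mset_le_1[of x G, OF x] add.IH y[of p] e[of p]
    by (intro add_mono mult_mono) auto
  finally show ?case by (simp add: algebra_simps)
qed simp

lemma borel_measurable_edge_weight: "(\<lambda>\<rho> :: real^'k::finite^'k. edge_weight \<rho> G) \<in> borel_measurable borel"
proof (induction G)
  case (add p G)
  have "(\<lambda>\<rho> :: real^'k::finite^'k. \<rho> $ fst p $ snd p) \<in> borel_measurable borel"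
    by (intro borel_measurable_continuous_onI continuous_intros)
  then have "(\<lambda>\<rho> :: real^'k::finite^'k. \<rho> $ fst p $ snd p * edge_weight \<rho> G) \<in> borel_measurable borel"
    using add by (rule borel_measurable_times)
  then show ?case by (simp add: edge_weight_def case_prod_beta)
qed (simp add: edge_weight_def)

lemma edge_weight_integrable:
  assumes \<Lambda>: "prob_space \<Lambda>" "sets \<Lambda> = sets borel" "AE \<rho> in \<Lambda>. supported_correlation P \<rho>"
  shows "integrable \<Lambda> (\<lambda>\<rho>. edge_weight \<rho> G)"
proof -
  interpret prob_space \<Lambda> by fact
  show ?thesis
  proof (rule integrable_const_bound[where B = 1])
    show "AE \<rho> in \<Lambda>. norm (edge_weight \<rho> G) \<le> 1"
      using \<Lambda>(3)
    proof (rule AE_mp, intro AE_I2 impI)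
      fix \<rho> assume "supported_correlation P \<rho>"
      then show "norm (edge_weight \<rho> G) \<le> 1"
        using abs_prod_mset_le_1[of "\<lambda>(i, j). \<rho> $ i $ j" G] abs_correlation_le
        by (auto simp: edge_weight_def)
    qed
    show "(\<lambda>\<rho>. edge_weight \<rho> G) \<in> borel_measurable \<Lambda>"
      using borel_measurable_edge_weight[of G] by (simp add: measurable_cong_sets[OF \<Lambda>(2) refl])
  qed
qed

text \<open>
  A vanishing distribution is replaced by a finitely supported one by rounding the matrix entries
  to multiples of \<open>1 / N\<close>; this avoids selecting \<open>\<mu>\<close> measurably in \<open>\<rho>\<close>, at the price of
  only approximate vanishing.
\<close>

lemma finite_almost_vanishing_mixture:
  fixes P :: "('k::finite \<Rightarrow> real) \<Rightarrow> real"
  assumes P: "even_function UNIV P" and van: "vanishing m P \<Lambda>" and \<gamma>: "\<gamma> > 0"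
  obtains M :: "('k \<Rightarrow> real) pmf pmf" where "finite (set_pmf M)"
    "\<And>\<mu>. \<mu> \<in> set_pmf M \<Longrightarrow> centered \<mu>" "\<And>\<mu>. \<mu> \<in> set_pmf M \<Longrightarrow> supported_distribution P \<mu>"
    "\<And>S G. S \<noteq> {} \<Longrightarrow> fourier_coeff UNIV P S \<noteq> 0 \<Longrightarrow> multigraph_on S G \<Longrightarrow> odd_degree S G \<Longrightarrow> size G \<le> m \<Longrightarrow>
      \<bar>measure_pmf.expectation M (\<lambda>\<mu>. edge_weight (correlation \<mu>) G)\<bar> \<le> \<gamma>"
proof -
  have \<Lambda>: "prob_space \<Lambda>" "sets \<Lambda> = sets borel" "AE \<rho> in \<Lambda>. supported_correlation P \<rho>"
    using van by (auto simp: vanishing_def)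
  interpret prob_space \<Lambda> by fact
  \<comment> \<open>A graph has at most \<open>m\<close> edges, and rounding changes each factor by
    at most \<open>1 / N\<close>; so the weight changes by at most
    \<open>m / N \<le> \<gamma>\<close>.\<close>
  obtain N :: nat where N: "real m / \<gamma> < real N" using reals_Archimedean2 by blast
  have N0: "N > 0" using N \<gamma> by (metis divide_nonneg_pos gr0I of_nat_0 of_nat_0_le_iff not_less)
  define q where "q \<rho> = (\<lambda>(i, j). \<lfloor>real N * \<rho> $ i $ j\<rfloor>)" for \<rho> :: "real^'k^'k"
  define F where "F = (\<Pi>\<^sub>E p\<in>(UNIV :: ('k \<times> 'k) set). {- int N..int N})"
  have F: "finite F" unfolding F_def by (intro finite_PiE) auto
  have qF: "q \<rho> \<in> F" if "supported_correlation P \<rho>" for \<rho>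
  proof -
    have "\<lfloor>real N * \<rho> $ i $ j\<rfloor> \<in> {- int N..int N}" for i j
    proof -
      have "\<bar>real N * \<rho> $ i $ j\<bar> \<le> real N"
        using abs_correlation_le[OF that, of i j] by (simp add: abs_mult mult_left_le)
      then show ?thesis by (auto simp: le_floor_iff floor_le_iff abs_le_iff)
    qed
    then show ?thesis by (auto simp: F_def q_def PiE_iff)
  qed
  have close: "\<bar>edge_weight \<rho> G - edge_weight \<rho>' G\<bar> \<le> size G / N"
    if "supported_correlation P \<rho>" "supported_correlation P \<rho>'" "q \<rho> = q \<rho>'" for \<rho> \<rho>' G
  proof -
    have "\<bar>\<rho> $ i $ j - \<rho>' $ i $ j\<bar> \<le> 1 / N" for i j
    proof -
      have "\<lfloor>real N * \<rho> $ i $ j\<rfloor> = \<lfloor>real N * \<rho>' $ i $ j\<rfloor>"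
        using fun_cong[OF that(3), of "(i, j)"] by (simp add: q_def)
      then have "\<bar>real N * \<rho> $ i $ j - real N * \<rho>' $ i $ j\<bar> \<le> 1" by linarith
      then have "real N * \<bar>\<rho> $ i $ j - \<rho>' $ i $ j\<bar> \<le> 1"
        by (simp add: abs_mult flip: right_diff_distrib)
      then show ?thesis using N0 by (simp add: field_simps)
    qed
    then show ?thesis unfolding edge_weight_def
      using abs_prod_mset_diff_le[of "\<lambda>(i, j). \<rho> $ i $ j" "\<lambda>(i, j). \<rho>' $ i $ j" "1 / real N" G]
        abs_correlation_le[OF that(1)] abs_correlation_le[OF that(2)] by auto
  qed
  have qm: "q \<in> measurable \<Lambda> (count_space UNIV)"
  proof -
    have "{\<rho> \<in> space \<Lambda>. q \<rho> = v} \<in> sets \<Lambda>" for v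
    proof -
      have [measurable]: "(\<lambda>\<rho> :: real^'k^'k. \<rho> $ i $ j) \<in> borel_measurable borel" for i j
        by (intro borel_measurable_continuous_onI continuous_intros)
      have "{\<rho> \<in> space borel. \<forall>i j. \<lfloor>real N * \<rho> $ i $ j\<rfloor> = v (i, j)} \<in> sets borel"
        by measurable
      moreover have "{\<rho> \<in> space \<Lambda>. q \<rho> = v} = {\<rho> \<in> space borel. \<forall>i j. \<lfloor>real N * \<rho> $ i $ j\<rfloor> = v (i, j)}"
        using sets_eq_imp_space_eq[OF \<Lambda>(2)] by (auto simp: q_def fun_eq_iff)
      ultimately show ?thesis using \<Lambda>(2) by simp
    qed
    then show ?thesis
      by (subst measurable_count_space_eq2_countable) (auto simp: vimage_def Int_def conj_commute)
  qed
  define D where "D = distr \<Lambda> (count_space UNIV) q"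
  define p where "p = Abs_pmf D"
  interpret D: prob_space D unfolding D_def by (rule prob_space_distr[OF qm])
  \<comment> \<open>The image of \<Lambda> under rounding is concentrated on the finite set
    \<open>F\<close>, hence discrete, and so comes from a pmf.\<close>
  have "AE v in D. v \<in> F"
    unfolding D_def using \<Lambda>(3) qm by (subst AE_distr_iff) (auto intro: qF)
  then have "\<exists>S. countable S \<and> (AE v in D. v \<in> S)" using countable_finite[OF F] by blast
  moreover have sD: "sets D = UNIV" by (simp add: D_def)
  ultimately have "AE v in D. measure D {v} \<noteq> 0" by (simp only: D.AE_support_countable)
  then have pD: "measure_pmf p = D"
    unfolding p_def using D.prob_space_axioms sD by (intro Abs_pmf_inverse) simp
  have p_ex: "\<exists>\<rho>. supported_correlation P \<rho> \<and> q \<rho> = v" if "v \<in> set_pmf p" for v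
  proof -
    have "AE v in measure_pmf p. \<exists>\<rho>. supported_correlation P \<rho> \<and> q \<rho> = v"
      unfolding pD unfolding D_def using \<Lambda>(3) qm by (subst AE_distr_iff) auto
    then show ?thesis using that by (simp add: AE_measure_pmf_iff)
  qed
  have ex: "\<exists>\<mu>. centered \<mu> \<and> supported_distribution P \<mu> \<and> q (correlation \<mu>) = q \<rho>"
    if \<rho>: "supported_correlation P \<rho>" for \<rho>
  proof -
    obtain \<mu> where \<mu>: "supported_distribution P \<mu>"
      "\<forall>i j. \<rho> $ i $ j = measure_pmf.expectation \<mu> (\<lambda>x. x i * x j)"
      using \<rho> by (auto simp: supported_correlation_def)
    obtain \<mu>' where \<mu>': "centered \<mu>'" "supported_distribution P \<mu>'"
      "\<forall>i j. measure_pmf.expectation \<mu>' (\<lambda>x. x i * x j) = measure_pmf.expectation \<mu> (\<lambda>x. x i * x j)"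
      by (rule symmetrize[OF P \<mu>(1)])
    have "correlation \<mu>' = \<rho>" using \<mu>(2) \<mu>'(3) by (simp add: correlation_def vec_eq_iff)
    then show ?thesis using \<mu>' by auto
  qed
  \<comment> \<open>For a value reached by a supported correlation matrix, this is a centered
    distribution whose correlations round to that value. By \<open>p_ex\<close>, all values in the
    support of \<open>p\<close> are of this kind.\<close>
  define sel where "sel v = (SOME \<mu>. centered \<mu> \<and> supported_distribution P \<mu> \<and> q (correlation \<mu>) = v)" for v
  have sel: "centered (sel (q \<rho>))" "supported_distribution P (sel (q \<rho>))" "q (correlation (sel (q \<rho>))) = q \<rho>"
    if "supported_correlation P \<rho>" for \<rho>
    using someI_ex[OF ex[OF that]] unfolding sel_def by auto
  have corr: "supported_correlation P (correlation \<mu>)" if "supported_distribution P \<mu>" for \<mu>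
    using that unfolding supported_correlation_def correlation_def by auto
  have pF: "set_pmf p \<subseteq> F" using p_ex qF by blast
  define M where "M = map_pmf sel p"
  show ?thesis
  proof (rule that[of M])
    show "finite (set_pmf M)" unfolding M_def using finite_subset[OF pF F] by simp
    show "centered \<mu>" "supported_distribution P \<mu>" if "\<mu> \<in> set_pmf M" for \<mu>
      using that p_ex sel by (auto simp: M_def)
  next
    fix S :: "'k set" and G assume SG: "S \<noteq> {}" "fourier_coeff UNIV P S \<noteq> 0" "multigraph_on S G" "odd_degree S G" "size G \<le> m"
    define w where "w v = edge_weight (correlation (sel v)) G" for v
    have wm: "(\<lambda>\<rho>. w (q \<rho>)) \<in> borel_measurable \<Lambda>"
      by (rule measurable_compose[OF qm]) simp
    have "AE \<rho> in \<Lambda>. norm (w (q \<rho>)) \<le> 1"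
      using \<Lambda>(3)
    proof (rule AE_mp, intro AE_I2 impI)
      fix \<rho> assume "supported_correlation P \<rho>"
      then show "norm (w (q \<rho>)) \<le> 1"
        using abs_prod_mset_le_1[of "\<lambda>(i, j). correlation (sel (q \<rho>)) $ i $ j" G]
          abs_correlation_le[OF corr[OF sel(2)]]
        by (auto simp: edge_weight_def w_def)
    qed
    then have wi: "integrable \<Lambda> (\<lambda>\<rho>. w (q \<rho>))"
      by (rule integrable_const_bound[OF _ wm])
    have "measure_pmf.expectation M (\<lambda>\<mu>. edge_weight (correlation \<mu>) G) = measure_pmf.expectation p w"
      unfolding M_def w_def by simp
    also have "\<dots> = (\<integral>\<rho>. w (q \<rho>) \<partial>\<Lambda>)"
      unfolding pD unfolding D_def by (rule integral_distr[OF qm]) simp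
    \<comment> \<open>The subtracted integral is 0 by the vanishing hypothesis, so only the rounding
      error remains to be bounded.\<close>
    also have "\<dots> = (\<integral>\<rho>. w (q \<rho>) \<partial>\<Lambda>) - (\<integral>\<rho>. edge_weight \<rho> G \<partial>\<Lambda>)"
      using van SG by (auto simp: vanishing_def)
    also have "\<dots> = (\<integral>\<rho>. w (q \<rho>) - edge_weight \<rho> G \<partial>\<Lambda>)"
      using wi edge_weight_integrable[OF \<Lambda>] by simp
    finally have "\<bar>measure_pmf.expectation M (\<lambda>\<mu>. edge_weight (correlation \<mu>) G)\<bar> \<le>
        (\<integral>\<rho>. \<bar>w (q \<rho>) - edge_weight \<rho> G\<bar> \<partial>\<Lambda>)"
      by (simp add: integral_abs_bound)
    also have "\<dots> \<le> (\<integral>\<rho>. \<gamma> \<partial>\<Lambda>)"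
    proof (rule integral_mono_AE)
      show "AE \<rho> in \<Lambda>. \<bar>w (q \<rho>) - edge_weight \<rho> G\<bar> \<le> \<gamma>"
        using \<Lambda>(3)
      proof (rule AE_mp, intro AE_I2 impI)
        fix \<rho> assume \<rho>: "supported_correlation P \<rho>"
        have "\<bar>w (q \<rho>) - edge_weight \<rho> G\<bar> \<le> size G / N"
          unfolding w_def using sel[OF \<rho>] by (intro close corr \<rho>) auto
        also have "\<dots> \<le> m / N" using SG by (intro divide_right_mono) auto
        also have "\<dots> \<le> \<gamma>" using N N0 \<gamma> by (simp add: field_simps)
        finally show "\<bar>w (q \<rho>) - edge_weight \<rho> G\<bar> \<le> \<gamma>" .
      qed
    qed (use wi edge_weight_integrable[OF \<Lambda>] in auto)
    also have "\<dots> = \<gamma>" by (simp add: prob_space)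
    finally show "\<bar>measure_pmf.expectation M (\<lambda>\<mu>. edge_weight (correlation \<mu>) G)\<bar> \<le> \<gamma>" .
  qed
qed

section \<open>The test\<close>

lemma expectation_bind_pmf_finite:
  fixes h :: "'b \<Rightarrow> real"
  assumes "finite (set_pmf p)" "\<And>x. x \<in> set_pmf p \<Longrightarrow> finite (set_pmf (f x))"
  shows "measure_pmf.expectation (p \<bind> f) h = measure_pmf.expectation p (\<lambda>x. measure_pmf.expectation (f x) h)"
proof -
  have "measure_pmf.expectation (p \<bind> f) h = (\<Sum>a\<in>set_pmf p. pmf p a *\<^sub>R measure_pmf.expectation (f a) h)"
    using assms by (intro pmf_expectation_bind) auto
  also have "\<dots> = measure_pmf.expectation p (\<lambda>x. measure_pmf.expectation (f x) h)"
    using assms by (intro integral_measure_pmf[symmetric]) auto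
  finally show ?thesis .
qed

text \<open>A single \<mu> is drawn and shared by all coordinates. The pair moments of different
  coordinates thus multiply to the weight of a multigraph for one matrix before the average over
  \<open>M\<close> is taken.\<close>

definition queries :: "real \<Rightarrow> ('k::finite \<Rightarrow> real) pmf pmf \<Rightarrow> 'i set \<Rightarrow> ('k \<Rightarrow> 'i \<Rightarrow> real) pmf" where
  "queries r M I = M \<bind> (\<lambda>\<mu>. iid_rows I (noisy r \<mu>))"

lemma abs_fourier_coeff_le:
  assumes "finite I" "\<And>x. x \<in> cube I \<Longrightarrow> \<bar>f x\<bar> \<le> 1" "S \<subseteq> I"
  shows "\<bar>fourier_coeff I f S\<bar> \<le> 1"
proof -
  have "(fourier_coeff I f S)\<^sup>2 \<le> (\<Sum>T\<in>Pow I. (fourier_coeff I f T)\<^sup>2)"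
    using assms by (intro member_le_sum) auto
  also have "\<dots> \<le> 1" by (rule sum_fourier_coeff_square_le[OF assms(1,2)])
  finally show ?thesis by (simp add: abs_square_le_1)
qed

lemma expectation_queries:
  fixes M :: "('k::finite \<Rightarrow> real) pmf pmf" and h :: "('k \<Rightarrow> 'i \<Rightarrow> real) \<Rightarrow> real"
  assumes I: "finite I" and M: "finite (set_pmf M)" "\<And>\<mu>. \<mu> \<in> set_pmf M \<Longrightarrow> set_pmf \<mu> \<subseteq> cube UNIV"
  shows "measure_pmf.expectation (queries r M I) h =
    measure_pmf.expectation M (\<lambda>\<mu>. measure_pmf.expectation (iid_rows I (noisy r \<mu>)) h)"
  unfolding queries_def using M by (intro expectation_bind_pmf_finite finite_set_iid_rows I set_noisy) auto

lemma acceptance_queries: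
  fixes M :: "('k::finite \<Rightarrow> real) pmf pmf"
  assumes M: "finite (set_pmf M)" "\<And>\<mu>. \<mu> \<in> set_pmf M \<Longrightarrow> set_pmf \<mu> \<subseteq> cube UNIV"
  shows "acceptance P (queries r M {1..n}) f =
    (\<Sum>S\<in>Pow UNIV. fourier_coeff UNIV P S * measure_pmf.expectation (queries r M {1..n}) (\<lambda>X. \<Prod>i\<in>S. f i (X i)))"
proof -
  have "finite (set_pmf (queries r M {1..n}))"
    unfolding queries_def using M by (auto intro!: finite_set_iid_rows set_noisy)
  then have "integrable (measure_pmf (queries r M {1..n})) h" for h :: "_ \<Rightarrow> real"
    by (rule integrable_measure_pmf_finite)
  then show ?thesis
    unfolding acceptance_def multilinear_ext_def by (simp add: Bochner_Integration.integral_sum)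
qed

text \<open>For a dictator only column \<open>l\<close> matters, and without noise it is always
  accepted. Noise changes the moment over \<open>S\<close> by the factor \<open>r ^ card S\<close>,
  and all of the \<open>2 ^ CARD('k)\<close> coefficients and moments are at most 1 in absolute
  value.\<close>

lemma queries_complete:
  fixes P :: "('k::finite \<Rightarrow> real) \<Rightarrow> real"
  assumes P: "\<And>x. x \<in> cube UNIV \<Longrightarrow> \<bar>P x\<bar> \<le> 1"
    and M: "finite (set_pmf M)" "\<And>\<mu>. \<mu> \<in> set_pmf M \<Longrightarrow> supported_distribution P \<mu>"
    and r: "0 \<le> r" "r \<le> 1" and l: "l \<in> {1..n}" and f: "\<And>i x. x \<in> cube {1..n} \<Longrightarrow> f i x = x l"
  shows "acceptance P (queries r M {1..n}) f \<ge> 1 - 2 ^ CARD('k) * (1 - r ^ CARD('k))"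
proof -
  have Mc: "set_pmf \<mu> \<subseteq> cube UNIV" if "\<mu> \<in> set_pmf M" for \<mu>
    using M(2)[OF that] by (auto simp: supported_distribution_def)
  have intM: "integrable (measure_pmf M) h" for h :: "_ \<Rightarrow> real"
    by (intro integrable_measure_pmf_finite M)
  define U where "U S = measure_pmf.expectation M (\<lambda>\<mu>. measure_pmf.expectation \<mu> (\<lambda>x. \<Prod>i\<in>S. x i))" for S :: "'k set"
  have U1: "\<bar>U S\<bar> \<le> 1" for S
    unfolding U_def by (intro abs_expectation_pmf_le abs_moment_le Mc)
  have V: "measure_pmf.expectation (queries r M {1..n}) (\<lambda>X. \<Prod>i\<in>S. f i (X i)) = r ^ card S * U S" for S
  proof -
    have "measure_pmf.expectation (iid_rows {1..n} (noisy r \<mu>)) (\<lambda>X. \<Prod>i\<in>S. f i (X i)) =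
        r ^ card S * measure_pmf.expectation \<mu> (\<lambda>x. \<Prod>i\<in>S. x i)" if \<mu>: "\<mu> \<in> set_pmf M" for \<mu>
    proof -
      define g where "g j x = (if j = l then \<Prod>i\<in>S. x i else 1)" for j :: nat and x :: "'k \<Rightarrow> real"
      have "measure_pmf.expectation (iid_rows {1..n} (noisy r \<mu>)) (\<lambda>X. \<Prod>i\<in>S. f i (X i)) =
          measure_pmf.expectation (iid_rows {1..n} (noisy r \<mu>)) (\<lambda>X. \<Prod>j\<in>{1..n}. g j (\<lambda>i. X i j))"
      proof (intro integral_cong_AE)
        have "X i \<in> cube {1..n}" if "X \<in> set_pmf (iid_rows {1..n} (noisy r \<mu>))" for X i
          by (rule iid_rows_in_cube[OF _ set_noisy[OF Mc[OF \<mu>]] that]) simp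
        then show "AE X in iid_rows {1..n} (noisy r \<mu>). (\<Prod>i\<in>S. f i (X i)) = (\<Prod>j\<in>{1..n}. g j (\<lambda>i. X i j))"
          using l by (simp add: AE_measure_pmf_iff f g_def prod.delta)
      qed auto
      also have "\<dots> = (\<Prod>j\<in>{1..n}. measure_pmf.expectation (noisy r \<mu>) (g j))"
        by (intro expectation_iid_rows_prod set_noisy Mc \<mu>) simp
      also have "\<dots> = (\<Prod>j\<in>{1..n}. if j = l then measure_pmf.expectation (noisy r \<mu>) (\<lambda>x. \<Prod>i\<in>S. x i) else 1)"
        by (intro prod.cong) (auto simp: g_def[abs_def])
      also have "\<dots> = r ^ card S * measure_pmf.expectation \<mu> (\<lambda>x. \<Prod>i\<in>S. x i)"
        using l expectation_noisy_monomial[OF Mc[OF \<mu>] r] by (simp add: prod.delta)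
      finally show ?thesis .
    qed
    then have "measure_pmf.expectation M (\<lambda>\<mu>. measure_pmf.expectation (iid_rows {1..n} (noisy r \<mu>)) (\<lambda>X. \<Prod>i\<in>S. f i (X i))) =
        measure_pmf.expectation M (\<lambda>\<mu>. r ^ card S * measure_pmf.expectation \<mu> (\<lambda>x. \<Prod>i\<in>S. x i))"
      by (intro integral_cong_AE) (auto simp: AE_measure_pmf_iff)
    then show ?thesis
      unfolding U_def using expectation_queries[OF _ M(1) Mc, of "{1..n}" r] by simp
  qed
  \<comment> \<open>Acceptance without noise, expressed through the same moments \<open>U S\<close>
    so that it can be compared with the noisy test term by term.\<close>
  have "1 = measure_pmf.expectation M (\<lambda>\<mu>. \<Sum>S\<in>Pow UNIV. fourier_coeff UNIV P S * measure_pmf.expectation \<mu> (\<lambda>x. \<Prod>i\<in>S. x i))"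
  proof -
    have "(\<Sum>S\<in>Pow UNIV. fourier_coeff UNIV P S * measure_pmf.expectation \<mu> (\<lambda>x. \<Prod>i\<in>S. x i)) = 1"
      if \<mu>: "\<mu> \<in> set_pmf M" for \<mu>
    proof -
      have int: "integrable (measure_pmf \<mu>) h" for h :: "_ \<Rightarrow> real"
        by (intro integrable_measure_pmf_finite finite_set_cube_pmf Mc \<mu>)
      have "(\<Sum>S\<in>Pow UNIV. fourier_coeff UNIV P S * measure_pmf.expectation \<mu> (\<lambda>x. \<Prod>i\<in>S. x i)) =
          measure_pmf.expectation \<mu> (multilinear_ext UNIV P)"
        unfolding multilinear_ext_def by (simp add: Bochner_Integration.integral_sum int)
      also have "\<dots> = measure_pmf.expectation \<mu> (\<lambda>_. 1)"
        using M(2)[OF \<mu>] by (intro integral_cong_AE)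
          (auto simp: AE_measure_pmf_iff supported_distribution_def multilinear_ext_on_cube)
      finally show ?thesis by simp
    qed
    then have "measure_pmf.expectation M (\<lambda>\<mu>. \<Sum>S\<in>Pow UNIV. fourier_coeff UNIV P S * measure_pmf.expectation \<mu> (\<lambda>x. \<Prod>i\<in>S. x i)) =
        measure_pmf.expectation M (\<lambda>_. 1)"
      by (intro integral_cong_AE) (auto simp: AE_measure_pmf_iff)
    then show ?thesis by simp
  qed
  also have "\<dots> = (\<Sum>S\<in>Pow UNIV. fourier_coeff UNIV P S * U S)"
    unfolding U_def by (simp add: Bochner_Integration.integral_sum intM)
  finally have one: "1 = (\<Sum>S\<in>Pow UNIV. fourier_coeff UNIV P S * U S)" .
  have "1 - acceptance P (queries r M {1..n}) f = (\<Sum>S\<in>Pow UNIV. fourier_coeff UNIV P S * U S) -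
      (\<Sum>S\<in>Pow UNIV. fourier_coeff UNIV P S * (r ^ card S * U S))"
    by (subst acceptance_queries[OF M(1) Mc]) (simp_all only: V flip: one)
  also have "\<dots> = (\<Sum>S\<in>Pow UNIV. fourier_coeff UNIV P S * U S * (1 - r ^ card S))"
    unfolding sum_subtractf[symmetric] by (intro sum.cong refl) (simp only: right_diff_distrib mult_1_right mult_ac)
  also have "\<dots> \<le> (\<Sum>S\<in>Pow (UNIV :: 'k set). 1 - r ^ CARD('k))"
  proof (intro sum_mono)
    fix S :: "'k set"
    have "fourier_coeff UNIV P S * U S * (1 - r ^ card S) \<le> \<bar>fourier_coeff UNIV P S\<bar> * \<bar>U S\<bar> * (1 - r ^ card S)"
      using r by (intro mult_right_mono) (auto simp: power_le_one abs_mult[symmetric])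
    also have "\<dots> \<le> 1 * (1 - r ^ card S)"
      using r U1 abs_fourier_coeff_le[of UNIV P S] P
      by (intro mult_right_mono mult_le_one) (auto simp: power_le_one)
    also have "\<dots> \<le> 1 - r ^ CARD('k)"
      using r by (simp add: power_decreasing card_mono)
    finally show "fourier_coeff UNIV P S * U S * (1 - r ^ card S) \<le> 1 - r ^ CARD('k)" .
  qed
  also have "\<dots> = 2 ^ CARD('k) * (1 - r ^ CARD('k))" by (simp add: card_Pow)
  finally show ?thesis by simp
qed

theorem theorem3:
  fixes P :: "('k::finite \<Rightarrow> real) \<Rightarrow> real"
  assumes "\<And>x. x \<in> cube UNIV \<Longrightarrow> P x \<in> {0, 1}"
    and "even_function UNIV P"
    and "\<And>m::nat. m > 0 \<Longrightarrow> \<exists>\<Lambda>. vanishing m P \<Lambda>"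
  shows "\<forall>\<epsilon>>0. \<exists>\<delta>>0. \<forall>n::nat. \<exists>\<T> :: ('k \<Rightarrow> nat \<Rightarrow> real) pmf.
    query_algorithm n \<T> \<and>
    (\<forall>f :: 'k \<Rightarrow> (nat \<Rightarrow> real) \<Rightarrow> real.
       (\<forall>i. odd_function {1..n} (f i) \<and> (\<forall>x\<in>cube {1..n}. f i x \<in> {-1..1})) \<longrightarrow>
       ((\<exists>l\<in>{1..n}. \<forall>i. \<forall>x\<in>cube {1..n}. f i x = x l) \<longrightarrow>
          acceptance P \<T> f \<ge> 1 - \<epsilon>) \<and>
       ((\<forall>i. \<forall>j\<in>{1..n}. low_degree_influence {1..n} (1 / \<delta>) j (f i) \<le> \<delta>) \<longrightarrow>
          acceptance P \<T> f \<le> fourier_coeff UNIV P {} + \<epsilon>))"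
proof (intro allI impI)
  fix \<epsilon> :: real assume \<epsilon>: "\<epsilon> > 0"
  define K where "K = CARD('k)"
  have P1: "\<bar>P x\<bar> \<le> 1" if "x \<in> cube UNIV" for x using assms(1)[OF that] by auto
  have K0: "K > 0" unfolding K_def by simp
  \<comment> \<open>By Bernoulli's inequality \<open>1 - r ^ K \<le> K * s\<close>, so the loss in
    \<open>queries_complete\<close> is at most \<epsilon>. The cap at 1 keeps \<open>r\<close>
    nonnegative.\<close>
  define s where "s = min 1 (\<epsilon> / (2 ^ K * real K))"
  define r where "r = 1 - s"
  have s: "0 < s" "s \<le> 1" "s \<le> \<epsilon> / (2 ^ K * real K)" unfolding s_def using \<epsilon> K0 by auto
  have r: "0 \<le> r" "r < 1" "r \<le> 1" using s by (auto simp: r_def)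
  have r\<epsilon>: "2 ^ K * (1 - r ^ K) \<le> \<epsilon>"
  proof -
    have "1 + real K * (- s) \<le> (1 + - s) ^ K" using s by (intro Bernoulli_inequality) auto
    then have "1 - r ^ K \<le> real K * s" by (simp add: r_def)
    also have "\<dots> \<le> real K * (\<epsilon> / (2 ^ K * real K))" using s by (intro mult_left_mono) auto
    also have "\<dots> = \<epsilon> / 2 ^ K" using K0 by simp
    finally show ?thesis by (simp add: field_simps)
  qed
  \<comment> \<open>The allowance for each of the \<open>2 ^ K\<close> sets \<open>S\<close>: one
    half pays for truncation, one quarter for imperfect vanishing and one quarter for coordinates
    shared by three characters.\<close>
  define \<eta> where "\<eta> = \<epsilon> / 2 ^ K"
  have \<eta>: "\<eta> > 0" using \<epsilon> by (simp add: \<eta>_def)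
  \<comment> \<open>Quantifying over all \<open>I\<close>, \<mu> and \<open>c\<close> makes the
    degrees \<open>D S\<close> independent of \<open>n\<close>, of the functions and of the mixture,
    which is chosen afterwards in terms of them.\<close>
  define good where "good S d \<longleftrightarrow> (\<forall>(I::nat set) \<mu> c W. finite I \<longrightarrow> centered \<mu> \<longrightarrow> (\<forall>i. smooth r I (c i)) \<longrightarrow>
    (\<forall>X\<in>set_pmf (iid_rows I \<mu>). \<bar>W X\<bar> \<le> 1) \<longrightarrow>
    \<bar>measure_pmf.expectation (iid_rows I \<mu>) (\<lambda>X. W X * (\<Prod>i\<in>S. multilinear I (c i) (X i))) -
     measure_pmf.expectation (iid_rows I \<mu>) (\<lambda>X. W X * (\<Prod>i\<in>S. multilinear I (truncate (d i) (c i)) (X i)))\<bar>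
      \<le> \<eta> / 2)" for S :: "'k set" and d :: "'k \<Rightarrow> nat"
  have "\<exists>d. good S d" for S
    unfolding good_def by (intro truncation r) (use \<eta> in simp)
  then obtain D where D: "\<And>S. good S (D S)" by metis
  \<comment> \<open>Dominates every single degree, as needed for the influences, and every sum of
    degrees over a set, as needed for the number of edges. \<open>Suc\<close> makes it positive, as
    the vanishing hypothesis requires.\<close>
  define m where "m = Suc (\<Sum>S\<in>UNIV. \<Sum>i\<in>UNIV. D S i)"
  define C where "C S = (\<Prod>i\<in>S. (2 ^ Suc (card S)) ^ D S i :: real)" for S
  define B where "B = (\<Sum>S\<in>UNIV. C S)"
  have C0: "C S > 0" for S unfolding C_def by (intro prod_pos) auto
  have CB: "C S \<le> B" for S unfolding B_def using C0 by (intro member_le_sum) (auto simp: less_imp_le)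
  have B0: "B > 0" using C0[of "{}"] CB[of "{}"] by linarith
  have D1: "(\<Sum>i\<in>UNIV. D S i) \<le> m" for S
  proof -
    have "(\<Sum>i\<in>UNIV. D S i) \<le> (\<Sum>S\<in>UNIV. \<Sum>i\<in>UNIV. D S i)" by (intro member_le_sum) auto
    then show ?thesis by (simp add: m_def)
  qed
  have D2: "(\<Sum>i\<in>S. D S i) \<le> m" for S
    by (rule order_trans[OF sum_mono2 D1]) auto
  have D3: "D S i \<le> m" for S i
    by (rule order_trans[OF member_le_sum D1]) auto
  have m0: "m > 0" by (simp add: m_def)
  \<comment> \<open>Since \<open>B\<close> bounds all constants \<open>C S\<close>, this value and
    the next one give \<open>B * \<gamma> = \<eta> / 4\<close> and
    \<open>B * 2 ^ K * \<sigma> * m = \<eta> / 4\<close>.\<close>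
  define \<gamma> where "\<gamma> = \<eta> / (4 * B)"
  have \<gamma>: "\<gamma> > 0" using \<eta> B0 by (simp add: \<gamma>_def)
  define \<sigma> where "\<sigma> = \<eta> / (4 * B * 2 ^ K * real m)"
  have \<sigma>: "\<sigma> > 0" using \<eta> B0 m0 by (simp add: \<sigma>_def)
  \<comment> \<open>The bound \<open>1 / m\<close> lets influences up to degree
    \<open>1 / \<delta>\<close> see every truncated character; the bound
    \<open>\<sigma>\<^sup>2\<close> makes the square roots of the influences small enough.\<close>
  define \<delta> where "\<delta> = min (1 / real m) (\<sigma>\<^sup>2)"
  have \<delta>: "\<delta> > 0" using \<sigma> m0 by (simp add: \<delta>_def)
  have \<delta>m: "real m \<le> 1 / \<delta>"
  proof -
    have "\<delta> \<le> 1 / real m" by (simp add: \<delta>_def)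
    then show ?thesis using \<delta> m0 by (simp add: field_simps)
  qed
  have \<delta>\<sigma>: "sqrt \<delta> \<le> \<sigma>" using \<sigma> by (intro real_le_lsqrt) (auto simp: \<delta>_def)
  obtain \<Lambda> where "vanishing m P \<Lambda>" using assms(3)[OF m0] by blast
  from finite_almost_vanishing_mixture[OF assms(2) this \<gamma>]
  obtain M :: "('k \<Rightarrow> real) pmf pmf" where M: "finite (set_pmf M)"
    "\<And>\<mu>. \<mu> \<in> set_pmf M \<Longrightarrow> centered \<mu>" "\<And>\<mu>. \<mu> \<in> set_pmf M \<Longrightarrow> supported_distribution P \<mu>"
    and Mv: "\<And>S G. S \<noteq> {} \<Longrightarrow> fourier_coeff UNIV P S \<noteq> 0 \<Longrightarrow> multigraph_on S G \<Longrightarrow> odd_degree S G \<Longrightarrow> size G \<le> m \<Longrightarrow>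
      \<bar>measure_pmf.expectation M (\<lambda>\<mu>. edge_weight (correlation \<mu>) G)\<bar> \<le> \<gamma>"
    by blast
  have Mc: "set_pmf \<mu> \<subseteq> cube UNIV" if "\<mu> \<in> set_pmf M" for \<mu>
    using M(2)[OF that] by (simp add: centered_def)
  have intM: "integrable (measure_pmf M) h" for h :: "_ \<Rightarrow> real"
    by (intro integrable_measure_pmf_finite M)
  have sound: "acceptance P (queries r M {1..n}) f \<le> fourier_coeff UNIV P {} + \<epsilon>"
    if odd: "\<And>i. odd_function {1..n} (f i)" and bd: "\<And>i x. x \<in> cube {1..n} \<Longrightarrow> \<bar>f i x\<bar> \<le> 1"
      and inf: "\<And>i j. j \<in> {1..n} \<Longrightarrow> low_degree_influence {1..n} (1 / \<delta>) j (f i) \<le> \<delta>"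
    for n and f :: "'k \<Rightarrow> (nat \<Rightarrow> real) \<Rightarrow> real"
  proof -
    let ?I = "{1..n}"
    define c where "c i T = r ^ card T * fourier_coeff ?I (f i) T" for i T
    have smooth: "smooth r ?I (c i)" for i
      unfolding c_def using bd r by (intro smooth_noise) auto
    define V where "V S = measure_pmf.expectation (queries r M ?I) (\<lambda>X. \<Prod>i\<in>S. f i (X i))" for S
    have V: "\<bar>V S\<bar> \<le> \<eta>" if S: "S \<noteq> {}" "fourier_coeff UNIV P S \<noteq> 0" for S
    proof -
      define E1 where "E1 \<mu> = measure_pmf.expectation (iid_rows ?I \<mu>) (\<lambda>X. \<Prod>i\<in>S. multilinear ?I (c i) (X i))" for \<mu>
      define E2 where "E2 \<mu> = measure_pmf.expectation (iid_rows ?I \<mu>)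
        (\<lambda>X. \<Prod>i\<in>S. multilinear ?I (truncate (D S i) (c i)) (X i))" for \<mu>
      have "V S = measure_pmf.expectation M (\<lambda>\<mu>. measure_pmf.expectation (iid_rows ?I (noisy r \<mu>)) (\<lambda>X. \<Prod>i\<in>S. f i (X i)))"
        unfolding V_def using Mc by (intro expectation_queries M) auto
      also have "\<dots> = measure_pmf.expectation M E1"
        unfolding E1_def c_def using Mc r
        by (intro integral_cong_AE) (auto simp: AE_measure_pmf_iff expectation_iid_rows_noisy)
      finally have VE: "V S = measure_pmf.expectation M (\<lambda>\<mu>. E1 \<mu> - E2 \<mu>) + measure_pmf.expectation M E2"
        by (simp add: intM)
      have t1: "\<bar>measure_pmf.expectation M (\<lambda>\<mu>. E1 \<mu> - E2 \<mu>)\<bar> \<le> \<eta> / 2"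
      proof (rule abs_expectation_pmf_le)
        fix \<mu> assume "\<mu> \<in> set_pmf M"
        then show "\<bar>E1 \<mu> - E2 \<mu>\<bar> \<le> \<eta> / 2"
          unfolding E1_def E2_def
          using D[of S, unfolded good_def, THEN spec[of _ ?I], THEN spec[of _ \<mu>], THEN spec[of _ c],
              THEN spec[of _ "\<lambda>_. 1"]] M(2) smooth by simp
      qed
      have "\<bar>measure_pmf.expectation M E2\<bar> \<le> C S * (\<gamma> + 2 ^ card S * (sqrt \<delta> * (\<Sum>i\<in>S. D S i)))"
        unfolding E2_def C_def
      proof (rule expectation_mixture_low_degree_le)
        fix i T assume T: "T \<subseteq> ?I" "truncate (D S i) (c i) T \<noteq> 0"
        then show "card T \<le> D S i" by (auto simp: truncate_def split: if_splits)
        show "odd (card T)"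
          using T odd_function_fourier_coeff[of ?I "f i" T] odd[of i]
          by (auto simp: truncate_def c_def split: if_splits)
      next
        fix i show "(\<Sum>T\<in>Pow ?I. (truncate (D S i) (c i) T)\<^sup>2) \<le> 1"
          using smooth by (intro sum_truncate_square_le) (simp add: smooth_def)
      next
        fix i j assume j: "j \<in> ?I"
        have "(\<Sum>T\<in>{T\<in>Pow ?I. j \<in> T}. (truncate (D S i) (c i) T)\<^sup>2) \<le>
            (\<Sum>T\<in>{T\<in>Pow ?I. j \<in> T}. if real (card T) \<le> 1 / \<delta> then (fourier_coeff ?I (f i) T)\<^sup>2 else 0)"
        proof (intro sum_mono)
          fix T :: "nat set"
          have "real (card T) \<le> 1 / \<delta>" if "card T \<le> D S i"
            using that D3[of S i] \<delta>m by linarith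
          moreover have "(r ^ card T * fourier_coeff ?I (f i) T)\<^sup>2 \<le> (fourier_coeff ?I (f i) T)\<^sup>2"
            unfolding power_mult_distrib using r by (intro mult_left_le_one_le) (auto intro!: power_le_one)
          ultimately show "(truncate (D S i) (c i) T)\<^sup>2 \<le>
              (if real (card T) \<le> 1 / \<delta> then (fourier_coeff ?I (f i) T)\<^sup>2 else 0)"
            by (auto simp: truncate_def c_def)
        qed
        also have "\<dots> = low_degree_influence ?I (1 / \<delta>) j (f i)"
          unfolding low_degree_influence_def by (intro sum.mono_neutral_cong_right) auto
        also have "\<dots> \<le> \<delta>" by (rule inf[OF j])
        finally show "(\<Sum>T\<in>{T\<in>Pow ?I. j \<in> T}. (truncate (D S i) (c i) T)\<^sup>2) \<le> \<delta>" .
      next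
        fix G assume "multigraph_on S G" "odd_degree S G" "size G \<le> (\<Sum>i\<in>S. D S i)"
        then show "\<bar>measure_pmf.expectation M (\<lambda>\<mu>. \<Prod>(a, b)\<in>#G. measure_pmf.expectation \<mu> (\<lambda>x. x a * x b))\<bar> \<le> \<gamma>"
          using Mv[OF S, of G] D2[of S] by (simp add: edge_weight_correlation)
      qed (use M \<delta> \<gamma> in auto)
      also have "\<dots> \<le> B * (\<gamma> + 2 ^ K * (\<sigma> * m))"
      proof (rule mult_mono)
        have \<sigma>m: "sqrt \<delta> * (\<Sum>i\<in>S. D S i) \<le> \<sigma> * m"
          using \<delta>\<sigma> \<sigma> D2[of S] by (intro mult_mono) (simp_all only: of_nat_le_iff of_nat_0_le_iff less_imp_le)
        have SK: "(2::real) ^ card S \<le> 2 ^ K"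
          unfolding K_def by (intro power_increasing card_mono) auto
        show "\<gamma> + 2 ^ card S * (sqrt \<delta> * (\<Sum>i\<in>S. D S i)) \<le> \<gamma> + 2 ^ K * (\<sigma> * m)"
          by (intro add_left_mono mult_mono[OF SK \<sigma>m])
            (use \<delta> in \<open>auto intro!: mult_nonneg_nonneg sum_nonneg\<close>)
        show "0 \<le> \<gamma> + 2 ^ card S * (sqrt \<delta> * (\<Sum>i\<in>S. D S i))"
          using \<gamma> \<delta> by (auto intro!: add_nonneg_nonneg mult_nonneg_nonneg sum_nonneg)
      qed (use CB B0 in auto)
      also have "\<dots> = \<eta> / 2"
        using B0 m0 by (simp add: \<gamma>_def \<sigma>_def field_simps)
      finally show ?thesis using t1 unfolding VE by linarith
    qed
    have V0: "V {} = 1" by (simp add: V_def)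
    have "acceptance P (queries r M ?I) f = (\<Sum>S\<in>Pow UNIV. fourier_coeff UNIV P S * V S)"
      unfolding V_def by (rule acceptance_queries[OF M(1) Mc])
    also have "\<dots> = fourier_coeff UNIV P {} + (\<Sum>S\<in>Pow UNIV - {{}}. fourier_coeff UNIV P S * V S)"
      by (subst sum.remove[of _ "{}"]) (auto simp: V0)
    also have "(\<Sum>S\<in>Pow UNIV - {{}}. fourier_coeff UNIV P S * V S) \<le> (\<Sum>S\<in>Pow (UNIV :: 'k set) - {{}}. \<eta>)"
    proof (intro sum_mono)
      fix S :: "'k set" assume S: "S \<in> Pow UNIV - {{}}"
      show "fourier_coeff UNIV P S * V S \<le> \<eta>"
      \<comment> \<open>Vanishing gives information only about sets with nonzero coefficient; the
        other sets contribute nothing to the acceptance probability.\<close>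
      proof (cases "fourier_coeff UNIV P S = 0")
        case False
        have "fourier_coeff UNIV P S * V S \<le> \<bar>fourier_coeff UNIV P S\<bar> * \<bar>V S\<bar>"
          by (simp add: abs_mult[symmetric])
        also have "\<dots> \<le> 1 * \<eta>"
          using V[OF _ False] S abs_fourier_coeff_le[of UNIV P S] P1 by (intro mult_mono) auto
        finally show ?thesis by simp
      qed (use \<eta> in simp)
    qed
    also have "\<dots> \<le> (\<Sum>S\<in>Pow (UNIV :: 'k set). \<eta>)"
      using \<eta> by (intro sum_mono2) auto
    also have "\<dots> = \<epsilon>" by (simp add: card_Pow \<eta>_def K_def)
    finally show ?thesis by simp
  qed
  show "\<exists>\<delta>>0. \<forall>n::nat. \<exists>\<T> :: ('k \<Rightarrow> nat \<Rightarrow> real) pmf.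
    query_algorithm n \<T> \<and>
    (\<forall>f :: 'k \<Rightarrow> (nat \<Rightarrow> real) \<Rightarrow> real.
       (\<forall>i. odd_function {1..n} (f i) \<and> (\<forall>x\<in>cube {1..n}. f i x \<in> {-1..1})) \<longrightarrow>
       ((\<exists>l\<in>{1..n}. \<forall>i. \<forall>x\<in>cube {1..n}. f i x = x l) \<longrightarrow>
          acceptance P \<T> f \<ge> 1 - \<epsilon>) \<and>
       ((\<forall>i. \<forall>j\<in>{1..n}. low_degree_influence {1..n} (1 / \<delta>) j (f i) \<le> \<delta>) \<longrightarrow>
          acceptance P \<T> f \<le> fourier_coeff UNIV P {} + \<epsilon>))"
  proof (intro exI[of _ \<delta>] conjI \<delta> allI)
    fix n
    show "\<exists>\<T> :: ('k \<Rightarrow> nat \<Rightarrow> real) pmf.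
    query_algorithm n \<T> \<and>
    (\<forall>f :: 'k \<Rightarrow> (nat \<Rightarrow> real) \<Rightarrow> real.
       (\<forall>i. odd_function {1..n} (f i) \<and> (\<forall>x\<in>cube {1..n}. f i x \<in> {-1..1})) \<longrightarrow>
       ((\<exists>l\<in>{1..n}. \<forall>i. \<forall>x\<in>cube {1..n}. f i x = x l) \<longrightarrow>
          acceptance P \<T> f \<ge> 1 - \<epsilon>) \<and>
       ((\<forall>i. \<forall>j\<in>{1..n}. low_degree_influence {1..n} (1 / \<delta>) j (f i) \<le> \<delta>) \<longrightarrow>
          acceptance P \<T> f \<le> fourier_coeff UNIV P {} + \<epsilon>))"
    proof (intro exI[of _ "queries r M {1..n}"] conjI allI impI)
      show "query_algorithm n (queries r M {1..n})"
        unfolding query_algorithm_def queries_def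
        using iid_rows_in_cube[OF finite_atLeastAtMost set_noisy[OF Mc]] by auto
    next
      fix f :: "'k \<Rightarrow> (nat \<Rightarrow> real) \<Rightarrow> real"
      assume "\<exists>l\<in>{1..n}. \<forall>i. \<forall>x\<in>cube {1..n}. f i x = x l"
      then obtain l where l: "l \<in> {1..n}" "\<And>i x. x \<in> cube {1..n} \<Longrightarrow> f i x = x l" by auto
      have "acceptance P (queries r M {1..n}) f \<ge> 1 - 2 ^ CARD('k) * (1 - r ^ CARD('k))"
        by (rule queries_complete[where f = f, OF P1 M(1,3) r(1,3) l])
      then show "acceptance P (queries r M {1..n}) f \<ge> 1 - \<epsilon>" using r\<epsilon> by (simp add: K_def)
    next
      fix f :: "'k \<Rightarrow> (nat \<Rightarrow> real) \<Rightarrow> real"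
      assume "\<forall>i. odd_function {1..n} (f i) \<and> (\<forall>x\<in>cube {1..n}. f i x \<in> {-1..1})"
        and "\<forall>i. \<forall>j\<in>{1..n}. low_degree_influence {1..n} (1 / \<delta>) j (f i) \<le> \<delta>"
      then show "acceptance P (queries r M {1..n}) f \<le> fourier_coeff UNIV P {} + \<epsilon>"
        by (intro sound) (auto simp: abs_le_iff)
    qed
  qed
qed

end
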